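(* Let $Y$ be a Banach space with a basis $(y_i)$. Let $\alpha<\omega_1$, $n\in\mathbb N$, $\varepsilon>0$, and let $\theta\ge 0$ be defined by $\theta^n=\delta_{[\mathcal S_\alpha]^n}(y_i)$. Then there exist a block basis $(x_i)\prec(y_i)$ and an equivalent norm $|\!|\!|\cdot|\!|\!|$ on $X=[x_i]$ such that $$\delta_\alpha\big((x_i),|\!|\!|\cdot|\!|\!|\big)\ge\theta-\varepsilon.$$
   Context: Spaces are separable infinite-dimensional Banach spaces. For a basic sequence $(x_i)$, $(y_i)\prec(x_i)$ means that $(y_i)$ is a (finite or infinite) block basis of $(x_i)$; $[x_i]$ is the closed linear span. For finite $F,G\subseteq\mathbb N$, $F<G$ means $\max F<\min G$ (or one is empty); $F\ge n$ means $\min F\ge n$. For sets $\mathcal F,\mathcal G$ of finite subsets of $\mathbb N$, $\mathcal F[\mathcal G]=\{\bigcup_1^nG_i: n\in\mathbb N, G_1<\dots<G_n, G_i\in\mathcal G, (\min G_i)_1^n\in\mathcal F\}$; $[\mathcal F]^1=\mathcal F$ and $[\mathcal F]^{n+1}=\mathcal F\big[[\mathcal F]^n\big]$. Schreier classes: $\mathcal S_0=\{\{n\}:n\in\mathbb N\}\cup\{\emptyset\}$, $\mathcal S_1=\{F:\min F\ge|F|\}\cup\{\emptyset\}$, $\mathcal S_{\alpha+1}=\mathcal S_1[\mathcal S_\alpha]$, and for a limit ordinal $\alpha<\omega_1$ one fixes $\alpha_n\uparrow\alpha$ and sets $\mathcal S_\alpha=\{F:\text{for some }n,\ F\in\mathcal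 S_{\alpha_n}\text{ and }F\ge n\}$. For a set $\mathcal F$ of finite subsets of $\mathbb N$ and a basic sequence $(x_i)$, a finite block sequence $(z_i)_1^k\prec(x_i)$ is $\mathcal F$-admissible w.r.t. $(x_i)$ if $(\min\operatorname{supp}(z_i))_{i=1}^k\in\mathcal F$ (supports w.r.t. $(x_i)$). $\delta_{\mathcal F}(x_i)$ is the supremum of $\delta\ge0$ such that $\|\sum_1^kz_i\|\ge\delta\sum_1^k\|z_i\|$ for all $(z_i)_1^k\prec(x_i)$ that are $\mathcal F$-admissible w.r.t. $(x_i)$; $\delta_{\mathcal F}((x_i),|\cdot|)$ is the same quantity computed in the norm $|\cdot|$; $\delta_\alpha=\delta_{\mathcal S_\alpha}$. *)

theory Defs
  imports "HOL-Analysis.Analysis" "HOL-Library.Countable_Set_Type"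
begin

section \<open>Countable ordinals\<close>

text \<open>
  The first uncountable ordinal as a type: the least uncountable cardinal, well-ordered in its
  initial order type. Its elements are (up to isomorphism) exactly the ordinals below
  \<open>\<omega>\<^sub>1\<close>, as confirmed by the two lemmas after the instance proof.
\<close>

typedef omega1 = "Field (cardSuc natLeq)"
proof -
  have "infinite (Field (cardSuc natLeq))"
    using cardSuc_finite[OF natLeq_Card_order] by (simp add: Field_natLeq)
  then show ?thesis using not_finite_existsD by fastforce
qed

lemma Well_order_cardSuc_natLeq: "Well_order (cardSuc natLeq)"
  using cardSuc_Card_order[OF natLeq_Card_order] by (simp add: card_order_on_def)

instantiation omega1 :: wellorder
begin

definition less_eq_omega1 :: "omega1 \<Rightarrow> omega1 \<Rightarrow> bool" where
  "a \<le> b \<longleftrightarrow> (Rep_omega1 a, Rep_omega1 b) \<in> cardSuc natLeq"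

definition less_omega1 :: "omega1 \<Rightarrow> omega1 \<Rightarrow> bool" where
  "(a::omega1) < b \<longleftrightarrow> a \<le> b \<and> a \<noteq> b"

instance
proof
  note W = Well_order_cardSuc_natLeq
  interpret wo_rel "cardSuc natLeq" using W by (simp add: wo_rel_def)
  fix x y z :: omega1
  show "x \<le> x" unfolding less_eq_omega1_def
    using REFL Rep_omega1[of x] by (simp add: refl_on_def)
  show "x \<le> y \<Longrightarrow> y \<le> z \<Longrightarrow> x \<le> z" unfolding less_eq_omega1_def
    using TRANS by (blast dest: transD)
  show anti: "x \<le> y \<Longrightarrow> y \<le> x \<Longrightarrow> x = y" for x y :: omega1 unfolding less_eq_omega1_def
    using ANTISYM by (metis antisymD Rep_omega1_inject)
  show "x \<le> y \<or> y \<le> x" unfolding less_eq_omega1_def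
    using TOTALS Rep_omega1 by blast
  show "x < y \<longleftrightarrow> x \<le> y \<and> \<not> y \<le> x"
    using anti \<open>x \<le> x\<close> unfolding less_omega1_def by blast
next
  fix P :: "omega1 \<Rightarrow> bool" and a
  assume step: "\<And>x. (\<And>y. y < x \<Longrightarrow> P y) \<Longrightarrow> P x"
  have "wf (cardSuc natLeq - Id)"
    using Well_order_cardSuc_natLeq by (simp add: well_order_on_def)
  then have "wf (inv_image (cardSuc natLeq - Id) Rep_omega1)" by (rule wf_inv_image)
  then show "P a"
  proof (induction a rule: wf_induct_rule)
    case (less x)
    show ?case
      by (rule step, rule less)
        (auto simp: less_omega1_def less_eq_omega1_def inv_image_def Rep_omega1_inject)
  qed
qed

end

lemma countable_below_omega1: "countable {b. b < (a :: omega1)}"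
proof -
  include cardinal_syntax
  have "|underS (cardSuc natLeq) (Rep_omega1 a)| <o cardSuc natLeq"
    by (rule card_of_underS[OF cardSuc_Card_order[OF natLeq_Card_order] Rep_omega1])
  then have "|underS (cardSuc natLeq) (Rep_omega1 a)| \<le>o natLeq"
    by (simp add: cardSuc_ordLeq_ordLess[OF natLeq_Card_order card_of_Card_order])
  then have "countable (underS (cardSuc natLeq) (Rep_omega1 a))"
    by (simp add: countable_card_le_natLeq)
  moreover have "Rep_omega1 ` {b. b < a} \<subseteq> underS (cardSuc natLeq) (Rep_omega1 a)"
    by (auto simp: underS_def less_omega1_def less_eq_omega1_def Rep_omega1_inject)
  ultimately have "countable (Rep_omega1 ` {b. b < a})" by (rule countable_subset[rotated])
  then show ?thesis
    by (rule countable_image_inj_on) (simp add: inj_on_def Rep_omega1_inject)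
qed

lemma uncountable_omega1: "uncountable (UNIV :: omega1 set)"
proof
  include cardinal_syntax
  assume "countable (UNIV :: omega1 set)"
  then have "countable (range Rep_omega1)" by (rule countable_image)
  then have "countable (Field (cardSuc natLeq))"
    by (simp add: type_definition.Rep_range[OF type_definition_omega1])
  then have "|Field (cardSuc natLeq)| \<le>o natLeq" by (simp add: countable_card_le_natLeq)
  moreover have "natLeq <o |Field (cardSuc natLeq)|"
    using cardSuc_greater[OF natLeq_Card_order]
      card_of_Field_ordIso[OF cardSuc_Card_order[OF natLeq_Card_order]]
    by (meson ordIso_symmetric ordLess_ordIso_trans)
  ultimately show False using not_ordLess_ordLeq by blast
qed

definition zero_ord :: "omega1 \<Rightarrow> bool" where
  "zero_ord \<alpha> \<longleftrightarrow> (\<forall>\<beta>. \<alpha> \<le> \<beta>)"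

definition succ_of :: "omega1 \<Rightarrow> omega1 \<Rightarrow> bool" where
  "succ_of \<beta> \<alpha> \<longleftrightarrow> \<beta> < \<alpha> \<and> (\<forall>\<gamma>. \<not> (\<beta> < \<gamma> \<and> \<gamma> < \<alpha>))"

definition limit_ord :: "omega1 \<Rightarrow> bool" where
  "limit_ord \<alpha> \<longleftrightarrow> \<not> zero_ord \<alpha> \<and> (\<nexists>\<beta>. succ_of \<beta> \<alpha>)"

text \<open>
  A choice, for every limit ordinal \<open>\<alpha>\<close>, of a sequence \<open>\<alpha>\<^sub>n \<up> \<alpha>\<close>, \<open>n = 1, 2, \<dots>\<close>
  (the value at \<open>n = 0\<close> is not used). Every theorem is to be stated for an arbitrary such choice.
\<close>

definition fundamental_system :: "(omega1 \<Rightarrow> nat \<Rightarrow> omega1) \<Rightarrow> bool" where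
  "fundamental_system e \<longleftrightarrow> (\<forall>\<alpha>. limit_ord \<alpha> \<longrightarrow>
     mono_on {1..} (e \<alpha>) \<and> (\<forall>n\<ge>1. e \<alpha> n < \<alpha>) \<and> (\<forall>\<beta><\<alpha>. \<exists>n\<ge>1. \<beta> < e \<alpha> n))"


section \<open>Families of finite sets and the Schreier classes\<close>

text \<open>All families below consist of finite sets of \<^emph>\<open>positive\<close> natural numbers.\<close>

definition set_less :: "nat set \<Rightarrow> nat set \<Rightarrow> bool" where
  "set_less F G \<longleftrightarrow> (\<forall>a\<in>F. \<forall>b\<in>G. a < b)"

text \<open>
  The family \<open>\<F>[\<G>]\<close>. The sets \<open>G\<^sub>i\<close> must be nonempty for their minima to make sense.
\<close>

definition fam_comp :: "nat set set \<Rightarrow> nat set set \<Rightarrow> nat set set" where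
  "fam_comp \<F> \<G> = {\<Union>i<k. G i | (k :: nat) G.
     (\<forall>i<k. G i \<in> \<G> \<and> G i \<noteq> {}) \<and>
     (\<forall>i j. i < j \<and> j < k \<longrightarrow> set_less (G i) (G j)) \<and>
     (\<lambda>i. Min (G i)) ` {..<k} \<in> \<F>}"

text \<open>The family \<open>[\<F>]\<^sup>n\<close>, meaningful for \<open>n \<ge> 1\<close>.\<close>

definition fam_power :: "nat set set \<Rightarrow> nat \<Rightarrow> nat set set" where
  "fam_power \<F> n = (fam_comp \<F> ^^ (n - 1)) \<F>"

lemma fam_power_1: "fam_power \<F> 1 = \<F>"
  by (simp add: fam_power_def)

lemma fam_power_Suc: "n \<ge> 1 \<Longrightarrow> fam_power \<F> (Suc n) = fam_comp \<F> (fam_power \<F> n)"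
  by (cases n) (simp_all add: fam_power_def)

definition schreier_zero :: "nat set set" where
  "schreier_zero = {{n} | n. n \<ge> 1} \<union> {{}}"

definition schreier_one :: "nat set set" where
  "schreier_one = {F. finite F \<and> F \<noteq> {} \<and> 1 \<le> Min F \<and> card F \<le> Min F} \<union> {{}}"

text \<open>
  The Schreier class \<open>\<S>\<^sub>\<alpha>\<close> with respect to the choice \<open>e\<close> of sequences at limit ordinals.
  The conjunct \<open>e \<alpha> n < \<alpha>\<close> only serves termination, being implied by
  \<open>fundamental_system e\<close>; the equations intended are those proved below.
\<close>

context
  notes conj_cong [fundef_cong]
begin

function schreier :: "(omega1 \<Rightarrow> nat \<Rightarrow> omega1) \<Rightarrow> omega1 \<Rightarrow> nat set set" where
  "schreier e \<alpha> = {F.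
     (zero_ord \<alpha> \<and> F \<in> schreier_zero) \<or>
     (\<exists>\<beta>. succ_of \<beta> \<alpha> \<and> F \<in> fam_comp schreier_one (schreier e \<beta>)) \<or>
     (limit_ord \<alpha> \<and> (\<exists>n\<ge>1. e \<alpha> n < \<alpha> \<and> F \<in> schreier e (e \<alpha> n) \<and> (\<forall>m\<in>F. n \<le> m)))}"
  by auto
termination
  by (relation "inv_image {(\<beta>, \<alpha>). \<beta> < \<alpha>} snd") (auto simp: succ_of_def wf)

end

declare schreier.simps [simp del]

lemma zero_ord_not_succ: "zero_ord \<alpha> \<Longrightarrow> \<not> succ_of \<beta> \<alpha>"
  by (auto simp: zero_ord_def succ_of_def not_less)

lemma succ_of_unique: "succ_of \<beta> \<alpha> \<Longrightarrow> succ_of \<beta>' \<alpha> \<Longrightarrow> \<beta> = \<beta>'"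
  unfolding succ_of_def by (metis neqE)

lemma schreier_zero: "zero_ord \<alpha> \<Longrightarrow> schreier e \<alpha> = schreier_zero"
  by (subst schreier.simps) (auto simp: zero_ord_not_succ limit_ord_def)

lemma schreier_succ:
  "succ_of \<beta> \<alpha> \<Longrightarrow> schreier e \<alpha> = fam_comp schreier_one (schreier e \<beta>)"
  by (subst schreier.simps) (auto simp: limit_ord_def dest: zero_ord_not_succ succ_of_unique)

lemma schreier_limit:
  "fundamental_system e \<Longrightarrow> limit_ord \<alpha> \<Longrightarrow>
   schreier e \<alpha> = {F. \<exists>n\<ge>1. F \<in> schreier e (e \<alpha> n) \<and> (\<forall>m\<in>F. n \<le> m)}"
  by (subst schreier.simps) (auto simp: limit_ord_def fundamental_system_def)

lemma schreier_one:
  assumes "zero_ord \<beta>" "succ_of \<beta> \<alpha>"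
  shows "schreier e \<alpha> = schreier_one"
proof -
  have "fam_comp schreier_one schreier_zero = schreier_one"
  proof (intro equalityI subsetI)
    fix F assume "F \<in> fam_comp schreier_one schreier_zero"
    then obtain k :: nat and G where F: "F = (\<Union>i<k. G i)"
      and G: "\<forall>i<k. G i \<in> schreier_zero \<and> G i \<noteq> {}"
      and m: "(\<lambda>i. Min (G i)) ` {..<k} \<in> schreier_one"
      unfolding fam_comp_def by blast
    have "G i = {Min (G i)}" if "i < k" for i
      using G that by (auto simp: schreier_zero_def)
    then have "F = (\<lambda>i. Min (G i)) ` {..<k}"
      unfolding F by blast
    with m show "F \<in> schreier_one" by simp
  next
    fix F assume F: "F \<in> schreier_one"
    then have fin: "finite F" and pos: "\<forall>m\<in>F. 1 \<le> m"
      by (force simp: schreier_one_def dest: Min_le)+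
    define l where "l = sorted_list_of_set F"
    have l: "set l = F" "sorted_wrt (<) l"
      using fin by (auto simp: l_def)
    have im: "F = (\<lambda>i. l ! i) ` {..<length l}"
      using l(1) by (auto simp: set_conv_nth)
    have "(\<forall>i<length l. {l ! i} \<in> schreier_zero \<and> {l ! i} \<noteq> {})"
      using pos l(1) by (auto simp: schreier_zero_def Suc_le_eq)
    moreover have "\<forall>i j. i < j \<and> j < length l \<longrightarrow> set_less {l ! i} {l ! j}"
      using l(2) by (auto simp: set_less_def sorted_wrt_iff_nth_less)
    moreover have "(\<lambda>i. Min {l ! i}) ` {..<length l} \<in> schreier_one"
      using F im by simp
    moreover have "F = (\<Union>i<length l. {l ! i})"
      using im by blast
    ultimately show "F \<in> fam_comp schreier_one schreier_zero"
      unfolding fam_comp_def by (intro CollectI exI[of _ "length l"] exI[of _ "\<lambda>i. {l ! i}"]) auto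
  qed
  then show ?thesis using assms by (simp add: schreier_succ schreier_zero)
qed


section \<open>Bases, blocks and the constants \<open>\<delta>\<close>\<close>

text \<open>
  A sequence \<open>x\<^sub>1, x\<^sub>2, \<dots>\<close> is represented by \<open>x :: nat \<Rightarrow> 'a\<close> with \<open>x i\<close> being the vector in
  position \<open>i + 1\<close>.
\<close>

definition schauder_basis :: "(nat \<Rightarrow> 'a::real_normed_vector) \<Rightarrow> bool" where
  "schauder_basis y \<longleftrightarrow> (\<forall>v. \<exists>!a. (\<lambda>i. a i *\<^sub>R y i) sums v)"

definition closed_span :: "(nat \<Rightarrow> 'a::real_normed_vector) \<Rightarrow> 'a set" where
  "closed_span x = closure (span (range x))"

text \<open>
  The support of a vector of the linear span of a (linearly independent, injective) sequence
  \<open>x\<close>, as a set of positions, hence of positive integers.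
\<close>

definition supp :: "(nat \<Rightarrow> 'a::real_normed_vector) \<Rightarrow> 'a \<Rightarrow> nat set" where
  "supp x v = {Suc i | i. representation (range x) v (x i) \<noteq> 0}"

text \<open>
  \<open>(z i)\<^sub>i\<^sub>\<in>\<^sub>I\<close> is a block sequence of \<open>x\<close>: nonzero, finitely supported, successive vectors.
  Finite block sequences have \<open>I = {..<k}\<close>, infinite ones \<open>I = UNIV\<close>.
\<close>

definition block_seq_on ::
    "nat set \<Rightarrow> (nat \<Rightarrow> 'a::real_normed_vector) \<Rightarrow> (nat \<Rightarrow> 'a) \<Rightarrow> bool" where
  "block_seq_on I z x \<longleftrightarrow>
     (\<forall>i\<in>I. z i \<in> span (range x) \<and> z i \<noteq> 0) \<and>
     (\<forall>i\<in>I. \<forall>j\<in>I. i < j \<longrightarrow> set_less (supp x (z i)) (supp x (z j)))"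

definition admissible ::
    "nat set set \<Rightarrow> nat \<Rightarrow> (nat \<Rightarrow> 'a::real_normed_vector) \<Rightarrow> (nat \<Rightarrow> 'a) \<Rightarrow> bool" where
  "admissible \<F> k z x \<longleftrightarrow>
     block_seq_on {..<k} z x \<and> (\<lambda>i. Min (supp x (z i))) ` {..<k} \<in> \<F>"

text \<open>
  \<open>\<delta>\<^sub>\<F>((x\<^sub>i), N)\<close> for a norm \<open>N\<close> on the closed span of \<open>x\<close>. For the families in use, which
  contain \<open>{1}\<close>, the set under the supremum is bounded by 1 and contains 0.
\<close>

definition delta ::
    "nat set set \<Rightarrow> ('a \<Rightarrow> real) \<Rightarrow> (nat \<Rightarrow> 'a::real_normed_vector) \<Rightarrow> real" where
  "delta \<F> N x = Sup {d. 0 \<le> d \<and>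
     (\<forall>k z. admissible \<F> k z x \<longrightarrow> N (\<Sum>i<k. z i) \<ge> d * (\<Sum>i<k. N (z i)))}"

definition equivalent_norm_on :: "'a::real_normed_vector set \<Rightarrow> ('a \<Rightarrow> real) \<Rightarrow> bool" where
  "equivalent_norm_on X N \<longleftrightarrow>
     (\<forall>v\<in>X. 0 \<le> N v \<and> (N v = 0 \<longleftrightarrow> v = 0)) \<and>
     (\<forall>v\<in>X. \<forall>c. N (c *\<^sub>R v) = \<bar>c\<bar> * N v) \<and>
     (\<forall>v\<in>X. \<forall>w\<in>X. N (v + w) \<le> N v + N w) \<and>
     (\<exists>c C. 0 < c \<and> 0 < C \<and> (\<forall>v\<in>X. c * norm v \<le> N v \<and> N v \<le> C * norm v))"

end

theory Submission
  imports Defs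
begin

text \<open>
  The block basis can be \<open>(y\<^sub>i)\<close> itself. Let \<open>0 < \<theta>' = \<theta> - \<epsilon>\<close>. The lower estimate is
  supermultiplicative, so \<open>[\<S>\<^sub>\<alpha>]\<^sup>n\<close> having constant \<open>\<theta>\<^sup>n\<close> gives \<open>[\<S>\<^sub>\<alpha>]\<^sup>M\<close> the constant
  \<open>\<theta>\<^sup>M\<close> for every multiple \<open>M\<close> of \<open>n\<close>. Let \<open>q\<^sub>j v\<close> be the supremum of \<open>\<Sum>\<parallel>E v\<parallel>\<close> over successive
  intervals \<open>E\<close> whose minima form a set of \<open>[\<S>\<^sub>\<alpha>]\<^sup>j\<close>, where \<open>E v\<close> is the basis projection.
  Filling the gaps between the intervals costs a factor depending only on the basis constant,
  and since \<open>\<theta>' < \<theta>\<close> this factor is absorbed for large \<open>M\<close>, that is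
  \<open>\<theta>'\<^sup>M q\<^sub>M \<le> \<parallel>\<cdot>\<parallel> \<le> q\<^sub>0\<close>. On the other hand \<open>q\<^sub>j\<^sub>+\<^sub>1 (\<Sum>z\<^sub>i) \<ge> \<Sum>q\<^sub>j z\<^sub>i\<close> for \<open>\<S>\<^sub>\<alpha>\<close>-admissible
  \<open>(z\<^sub>i)\<close>. Hence the norm \<open>N = \<Sum>\<^sub>j\<^sub><\<^sub>M \<theta>'\<^sup>j q\<^sub>j\<close> satisfies \<open>N (\<Sum>z\<^sub>i) \<ge> \<theta>' \<Sum>N z\<^sub>i\<close>.
\<close>

section \<open>Bases and the basis constant\<close>

lemma representation_image:
  assumes ind: "independent (range y)" and inj: "inj y" and fin: "finite A"
  shows "representation (range y) (\<Sum>i\<in>A. a i *\<^sub>R y i) (y i) = (if i \<in> A then a i else 0)"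
proof -
  have "representation (range y) (\<Sum>i\<in>A. a i *\<^sub>R y i) = (\<lambda>b. \<Sum>i\<in>A. a i *\<^sub>R representation (range y) (y i) b)"
    using ind by (simp add: representation_sum representation_scale span_base span_scale)
  then show ?thesis
    using ind inj fin by (simp add: representation_basis inj_eq if_distrib cong: if_cong)
qed

section \<open>Coordinate functionals of a Schauder basis, and supports\<close>

locale basis_seq =
  fixes y :: "nat \<Rightarrow> 'a::banach"
  assumes basis: "schauder_basis y"
begin

definition coef :: "'a \<Rightarrow> nat \<Rightarrow> real" where
  "coef v = (THE a. (\<lambda>i. a i *\<^sub>R y i) sums v)"

lemma coef_sums: "(\<lambda>i. coef v i *\<^sub>R y i) sums v"
  unfolding coef_def using basis theI'[of "\<lambda>a. (\<lambda>i. a i *\<^sub>R y i) sums v"]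
  unfolding schauder_basis_def by blast

lemma coef_unique: "(\<lambda>i. a i *\<^sub>R y i) sums v \<Longrightarrow> coef v = a"
  using basis coef_sums[of v] unfolding schauder_basis_def by blast

lemma coef_add: "coef (v + w) i = coef v i + coef w i"
  using coef_unique[of "\<lambda>i. coef v i + coef w i" "v + w"] sums_add[OF coef_sums[of v] coef_sums[of w]]
  by (simp add: scaleR_add_left)

lemma coef_scale: "coef (c *\<^sub>R v) i = c * coef v i"
  using coef_unique[of "\<lambda>i. c * coef v i" "c *\<^sub>R v"] sums_scaleR_right[OF coef_sums[of v], of c]
  by simp

lemma coef_zero [simp]: "coef 0 i = 0"
  using coef_scale[of 0 0 i] by simp

lemma coef_sum: "coef (sum z I) i = (\<Sum>k\<in>I. coef (z k) i)"
  by (induction I rule: infinite_finite_induct) (auto simp: coef_add)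

lemma coef_diff: "coef (v - w) i = coef v i - coef w i"
  using coef_add[of "v - w" w i] by simp

lemma coef_finite_sum:
  assumes "finite A"
  shows "coef (\<Sum>i\<in>A. a i *\<^sub>R y i) i = (if i \<in> A then a i else 0)"
proof -
  have "(\<lambda>i. (if i \<in> A then a i else 0) *\<^sub>R y i) sums (\<Sum>i\<in>A. (if i \<in> A then a i else 0) *\<^sub>R y i)"
    by (rule sums_finite[OF assms]) auto
  also have "(\<Sum>i\<in>A. (if i \<in> A then a i else 0) *\<^sub>R y i) = (\<Sum>i\<in>A. a i *\<^sub>R y i)"
    by (rule sum.cong) auto
  finally show ?thesis by (simp add: coef_unique)
qed

lemma coef_basis: "coef (y j) i = (if i = j then 1 else 0)"
  using coef_finite_sum[of "{j}" "\<lambda>_. 1" i] by auto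

lemma basis_nonzero: "y i \<noteq> 0"
  using coef_basis[of i i] by auto

lemma basis_inj: "inj y"
  by (rule injI) (metis coef_basis zero_neq_one)

lemma basis_independent: "independent (range y)"
proof -
  have "u v = 0" if t: "finite t" "t \<subseteq> range y" "(\<Sum>v\<in>t. u v *\<^sub>R v) = 0" "v \<in> t" for t u v
  proof -
    obtain A where A: "t = y ` A" using t(2) by (auto simp: subset_image_iff)
    have inj: "inj_on y A" using basis_inj by (rule inj_on_subset) auto
    have fin: "finite A" using t(1) inj unfolding A by (rule finite_imageD)
    obtain j where j: "j \<in> A" "v = y j" using t(4) A by auto
    have "(\<Sum>i\<in>A. u (y i) *\<^sub>R y i) = 0"
      using t(3) unfolding A by (simp add: sum.reindex[OF inj])
    then have "coef (\<Sum>i\<in>A. u (y i) *\<^sub>R y i) j = 0" by simp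
    then show ?thesis using coef_finite_sum[OF fin, of "\<lambda>i. u (y i)" j] j by simp
  qed
  then show ?thesis by (auto simp: dependent_explicit)
qed

lemma span_expand:
  assumes "v \<in> span (y ` B)"
  obtains A where "finite A" "A \<subseteq> B" "v = (\<Sum>i\<in>A. coef v i *\<^sub>R y i)"
proof -
  obtain t u where t: "finite t" "t \<subseteq> y ` B" "v = (\<Sum>b\<in>t. u b *\<^sub>R b)"
    using assms unfolding span_explicit by blast
  obtain A where A: "A \<subseteq> B" "t = y ` A" using t(2) by (auto simp: subset_image_iff)
  have inj: "inj_on y A" using basis_inj by (rule inj_on_subset) auto
  have fin: "finite A" using t(1) inj unfolding A by (rule finite_imageD)
  have v: "v = (\<Sum>i\<in>A. u (y i) *\<^sub>R y i)"
    using t(3) unfolding A by (simp add: sum.reindex[OF inj])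
  have "coef v i = u (y i)" if "i \<in> A" for i
    using that fin unfolding v by (subst coef_finite_sum) auto
  then have "v = (\<Sum>i\<in>A. coef v i *\<^sub>R y i)"
    by (subst v) (simp cong: sum.cong)
  then show thesis using that fin A by blast
qed

lemma span_coef:
  assumes "v \<in> span (y ` B)"
  shows "finite {i. coef v i \<noteq> 0}" "{i. coef v i \<noteq> 0} \<subseteq> B"
proof -
  obtain A where A: "finite A" "A \<subseteq> B" "v = (\<Sum>i\<in>A. coef v i *\<^sub>R y i)"
    using span_expand assms by blast
  have "coef v i = 0" if "i \<notin> A" for i
    using that by (subst A(3), subst coef_finite_sum) (use A in auto)
  then have "{i. coef v i \<noteq> 0} \<subseteq> A" by auto
  then show "finite {i. coef v i \<noteq> 0}" "{i. coef v i \<noteq> 0} \<subseteq> B"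
    using A finite_subset by auto
qed

text \<open>On the linear span the Hamel coordinates behind \<open>supp\<close> are the Schauder
  coefficients, by uniqueness of finite expansions; from here on supports can be read off
  \<open>coef\<close>.\<close>

lemma supp_coef:
  assumes "v \<in> span (range y)"
  shows "supp y v = {Suc i | i. coef v i \<noteq> 0}"
proof -
  obtain A where A: "finite A" "A \<subseteq> UNIV" "v = (\<Sum>i\<in>A. coef v i *\<^sub>R y i)"
    using span_expand assms by blast
  have "representation (range y) v (y i) = coef v i" for i
    using representation_image[OF basis_independent basis_inj A(1), of "coef v" i]
      coef_finite_sum[OF A(1), of "coef v" i] by (simp flip: A(3))
  then show ?thesis by (simp add: supp_def)
qed

lemma coef_eq_0_iff: "(\<forall>i. coef v i = 0) \<longleftrightarrow> v = 0"
proof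
  assume "\<forall>i. coef v i = 0"
  then have "(\<lambda>i. 0) sums v" using coef_sums[of v] by simp
  then show "v = 0" using sums_zero by (rule sums_unique2)
qed simp

section \<open>Uniform boundedness of the partial sum projections\<close>

definition psum :: "nat \<Rightarrow> 'a \<Rightarrow> 'a" where
  "psum n v = (\<Sum>i<n. coef v i *\<^sub>R y i)"

lemma psum_tendsto: "(\<lambda>n. psum n v) \<longlonglongrightarrow> v"
  using coef_sums[of v] by (simp add: sums_def psum_def)

lemma psum_diff: "psum n (v - w) = psum n v - psum n w"
  by (simp add: psum_def coef_diff scaleR_left_diff_distrib sum_subtractf)

lemma psum_scale: "psum n (c *\<^sub>R v) = c *\<^sub>R psum n v"
  by (simp add: psum_def coef_scale scaleR_sum_right)

lemma psum_zero [simp]: "psum n 0 = 0"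
  by (simp add: psum_def)

text \<open>Baire category, followed by the usual symmetrization of the ball that is found.\<close>

lemma psum_approx:
  obtains C where "C \<ge> 0"
    "\<And>w \<eta>. \<eta> > 0 \<Longrightarrow> \<exists>u. norm (w - u) < \<eta> \<and> (\<forall>n. norm (psum n u) \<le> C * norm w)"
proof -
  define A where "A m = {v. \<forall>n. norm (psum n v) \<le> real m}" for m
  have "\<exists>m. v \<in> A m" for v
  proof -
    have "Bseq (\<lambda>n. psum n v)" using psum_tendsto convergentI convergent_imp_Bseq by blast
    then obtain K where "\<forall>n. norm (psum n v) \<le> K" by (auto simp: Bseq_def)
    moreover obtain m where "K \<le> real m" using real_arch_simple by blast
    ultimately show ?thesis unfolding A_def by (auto intro: order_trans)
  qed
  then have U: "(\<Union>m. closure (A m)) = UNIV" using closure_subset by fastforce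
  have "\<exists>m. interior (closure (A m)) \<noteq> {}"
  proof (rule ccontr)
    assume "\<not> ?thesis"
    then have "euclidean interior_of \<Union>(range (\<lambda>m. closure (A m))) = {}"
      by (intro Baire_category_alt) (auto simp: completely_metrizable_space_euclidean)
    then show False using U by simp
  qed
  then obtain m x r where r: "r > 0" "ball x r \<subseteq> closure (A m)"
    by (metis ex_in_conv mem_interior)
  have near: "\<exists>u\<in>A m. norm (w - u) < \<eta>" if "norm w < r" "\<eta> > 0" for w \<eta>
  proof -
    have "x + w \<in> closure (A m)" "x - w \<in> closure (A m)"
      using that r by (auto simp: dist_norm subset_iff)
    then obtain p q where p: "p \<in> A m" "dist p (x + w) < \<eta>" and q: "q \<in> A m" "dist q (x - w) < \<eta>"
      using \<open>\<eta> > 0\<close> unfolding closure_approachable by metis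
    \<comment> \<open>Since \<open>w\<close> is half of \<open>(x + w) - (x - w)\<close>, half the
      difference of the two approximants is near \<open>w\<close>, and it inherits the bound
      \<open>m\<close>.\<close>
    define u where "u = (1/2) *\<^sub>R (p - q)"
    have "norm (psum n u) \<le> real m" for n
    proof -
      have "norm (psum n u) = (1/2) * norm (psum n p - psum n q)"
        by (simp add: u_def psum_scale psum_diff)
      also have "\<dots> \<le> (1/2) * (norm (psum n p) + norm (psum n q))"
        using norm_triangle_ineq4 by (intro mult_left_mono) auto
      also have "\<dots> \<le> real m" using p(1) q(1) by (simp add: A_def) (smt (verit) field_sum_of_halves)
      finally show ?thesis .
    qed
    moreover have "norm (w - u) < \<eta>"
    proof -
      have "w - u = (1/2) *\<^sub>R ((x + w - p) - (x - w - q))"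
        by (simp add: u_def algebra_simps flip: scaleR_add_left)
      then have "norm (w - u) \<le> (1/2) * (norm (x + w - p) + norm (x - w - q))"
        using norm_triangle_ineq4[of "x + w - p" "x - w - q"] by simp
      also have "\<dots> < \<eta>" using p(2) q(2) by (simp add: dist_norm norm_minus_commute)
      finally show ?thesis .
    qed
    ultimately show ?thesis by (auto simp: A_def)
  qed
  show thesis
  proof (rule that[of "2 * real m / r"])
    show "0 \<le> 2 * real m / r" using r by simp
    fix w :: 'a and \<eta> :: real assume "\<eta> > 0"
    show "\<exists>u. norm (w - u) < \<eta> \<and> (\<forall>n. norm (psum n u) \<le> 2 * real m / r * norm w)"
    proof (cases "w = 0")
      case True
      then show ?thesis using \<open>\<eta> > 0\<close> by (intro exI[of _ 0]) auto
    next
      case False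
      \<comment> \<open>Scaling by \<open>t\<close> brings \<open>w\<close> to norm
        \<open>r / 2\<close>, inside the ball; the tolerance is scaled along, so that dividing by
        \<open>t\<close> restores \<open>\<eta>\<close>.\<close>
      define t where "t = r / (2 * norm w)"
      have t: "t > 0" using r False by (simp add: t_def)
      have "norm (t *\<^sub>R w) < r" using r False by (simp add: t_def)
      then obtain u where u: "u \<in> A m" "norm (t *\<^sub>R w - u) < \<eta> * t"
        using near[of "t *\<^sub>R w" "\<eta> * t"] t \<open>\<eta> > 0\<close> by auto
      have "w - inverse t *\<^sub>R u = inverse t *\<^sub>R (t *\<^sub>R w - u)"
        using t by (simp add: algebra_simps)
      then have "norm (w - inverse t *\<^sub>R u) = norm (t *\<^sub>R w - u) / t"
        using t by (simp add: divide_inverse)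
      also have "\<dots> < \<eta>" using u(2) t by (simp add: divide_less_eq)
      finally have 1: "norm (w - inverse t *\<^sub>R u) < \<eta>" .
      have "norm (psum n (inverse t *\<^sub>R u)) \<le> 2 * real m / r * norm w" for n
      proof -
        have "norm (psum n (inverse t *\<^sub>R u)) = inverse t * norm (psum n u)"
          using t by (simp add: psum_scale)
        also have "\<dots> \<le> inverse t * real m"
          using u(1) t by (intro mult_left_mono) (auto simp: A_def)
        also have "\<dots> = 2 * real m / r * norm w" by (simp add: t_def)
        finally show ?thesis .
      qed
      with 1 show ?thesis by blast
    qed
  qed
qed

text \<open>
  As in the open mapping theorem, \<open>v\<close> is written as a series of vectors with uniformly small
  partial sums; by uniqueness of expansions their coefficients add up to those of \<open>v\<close>.
\<close>

lemma psum_bounded: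
  obtains K where "K \<ge> 1" "\<And>n v. norm (psum n v) \<le> K * norm v"
proof -
  obtain C where C: "C \<ge> 0"
    and approx: "\<And>w \<eta>. \<eta> > 0 \<Longrightarrow> \<exists>u. norm (w - u) < \<eta> \<and> (\<forall>n. norm (psum n u) \<le> C * norm w)"
    using psum_approx by blast
  define ap where "ap w \<eta> = (SOME u. norm (w - u) < \<eta> \<and> (\<forall>n. norm (psum n u) \<le> C * norm w))" for w \<eta>
  have ap: "norm (w - ap w \<eta>) < \<eta>" "norm (psum n (ap w \<eta>)) \<le> C * norm w" if "\<eta> > 0" for w \<eta> n
    using someI_ex[OF approx[OF that]] unfolding ap_def by blast+
  have "norm (psum n v) \<le> 2 * C * norm v" for n v
  proof (cases "v = 0")
    case False
    \<comment> \<open>\<open>R k\<close> is the remainder after \<open>k\<close> approximations.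
      Each error allowance is half the previous one, so the remainders and the bounds
      \<open>M k\<close> decay geometrically.\<close>
    define R where "R = rec_nat v (\<lambda>k R. R - ap R (norm v * (1/2) ^ Suc k))"
    define u where "u k = ap (R k) (norm v * (1/2) ^ Suc k)" for k
    have RS: "R (Suc k) = R k - u k" for k by (simp add: R_def u_def)
    have R: "norm (R k) \<le> norm v * (1/2) ^ k" for k
    proof (cases k)
      case (Suc j)
      have "norm (R j - u j) < norm v * (1/2) ^ Suc j"
        unfolding u_def by (rule ap) (use False in simp)
      then show ?thesis using RS Suc by simp
    qed (simp add: R_def)
    define M where "M k = C * norm v * (1/2) ^ k" for k
    have M: "norm (psum j (u k)) \<le> M k" for j k
    proof -
      have "norm (psum j (u k)) \<le> C * norm (R k)"
        unfolding u_def by (rule ap) (use False in simp)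
      also have "\<dots> \<le> M k" using mult_left_mono[OF R C, of k] by (simp add: M_def mult.assoc)
      finally show ?thesis .
    qed
    have summ: "M sums (2 * C * norm v)"
      using sums_mult[OF geometric_sums[of "1/2 :: real"], of "C * norm v"] by (simp add: M_def[abs_def] mult_ac)
    have psum_step: "coef w i *\<^sub>R y i = psum (Suc i) w - psum i w" for w i
      by (simp add: psum_def)
    have sm: "summable (\<lambda>k. psum j (u k))" for j
      by (rule summable_comparison_test'[OF sums_summable[OF summ], of 0]) (simp add: M)
    \<comment> \<open>Bounds on two consecutive partial sums control one term of the expansion;
      dividing by the norm of \<open>y i\<close>, which is nonzero, controls the
      coefficient.\<close>
    have sm_coef: "summable (\<lambda>k. coef (u k) i)" for i
    proof -
      have "summable (\<lambda>k. norm (coef (u k) i *\<^sub>R y i))"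
      proof (rule summable_comparison_test'[OF summable_mult[OF sums_summable[OF summ], of 2], of 0])
        fix k
        show "norm (norm (coef (u k) i *\<^sub>R y i)) \<le> 2 * M k"
          unfolding psum_step using norm_triangle_ineq4[of "psum (Suc i) (u k)" "psum i (u k)"]
            M[of i k] M[of "Suc i" k] by simp
      qed
      then have "summable (\<lambda>k. norm (y i) * norm (coef (u k) i))" by (simp add: mult.commute)
      then have "summable (\<lambda>k. norm (coef (u k) i))"
        by (rule summable_mult_D) (simp add: basis_nonzero)
      then show ?thesis by (rule summable_norm_cancel)
    qed
    define a where "a i = (\<Sum>k. coef (u k) i)" for i
    have T: "(\<Sum>i<j. a i *\<^sub>R y i) = (\<Sum>k. psum j (u k))" for j
    proof -
      have "(\<Sum>i<j. a i *\<^sub>R y i) = (\<Sum>i<j. \<Sum>k. coef (u k) i *\<^sub>R y i)"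
        unfolding a_def by (intro sum.cong refl suminf_scaleR_left sm_coef)
      also have "\<dots> = (\<Sum>k. \<Sum>i<j. coef (u k) i *\<^sub>R y i)"
        by (rule suminf_sum[symmetric]) (rule summable_scaleR_left[OF sm_coef])
      finally show ?thesis by (simp add: psum_def)
    qed
    have part: "(\<Sum>k<m. u k) = v - R m" for m
      by (induction m) (simp_all add: RS, simp add: R_def)
    have "R \<longlonglongrightarrow> 0"
    proof (rule Lim_null_comparison)
      show "\<forall>\<^sub>F k in sequentially. norm (R k) \<le> norm v * (1/2) ^ k" using R by simp
      show "(\<lambda>k. norm v * (1/2) ^ k) \<longlonglongrightarrow> 0"
        by (intro tendsto_mult_right_zero LIMSEQ_power_zero) simp
    qed
    then have usum: "(\<lambda>m. \<Sum>k<m. u k) \<longlonglongrightarrow> v"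
      unfolding part using tendsto_diff[OF tendsto_const[of v], of R 0] by simp
    \<comment> \<open>Uniform convergence in \<open>j\<close> permits exchanging the limits in
      \<open>j\<close> and \<open>m\<close>; this is what makes the coefficients \<open>a\<close>
      expand \<open>v\<close>.\<close>
    have "uniform_limit UNIV (\<lambda>m j. \<Sum>k<m. psum j (u k)) (\<lambda>j. \<Sum>k. psum j (u k)) sequentially"
      by (rule Weierstrass_m_test[OF _ sums_summable[OF summ]]) (rule M)
    moreover have "(\<lambda>j. \<Sum>k<m. psum j (u k)) \<longlonglongrightarrow> (\<Sum>k<m. u k)" for m
      by (intro tendsto_sum psum_tendsto)
    ultimately have "(\<lambda>j. \<Sum>k. psum j (u k)) \<longlonglongrightarrow> v"
      by (intro swap_uniform_limit'[OF always_eventually usum _ always_eventually]) auto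
    then have "(\<lambda>i. a i *\<^sub>R y i) sums v" by (simp add: sums_def T)
    then have "psum n v = (\<Sum>k. psum n (u k))" using T[of n] coef_unique by (simp add: psum_def)
    also have "norm \<dots> \<le> (\<Sum>k. M k)"
      by (rule norm_suminf_le[OF M sums_summable[OF summ]])
    also have "\<dots> = 2 * C * norm v" using summ by (simp add: sums_iff)
    finally show ?thesis .
  qed simp
  then have "norm (psum n v) \<le> max 1 (2 * C) * norm v" for n v
    by (meson max.cobounded2 mult_right_mono norm_ge_zero order_trans)
  then show thesis using that[of "max 1 (2 * C)"] by simp
qed

end


section \<open>Hereditary and spreading families\<close>

text \<open>Hereditary and spreading in one clause: subsets may be taken and moved to the right.\<close>

definition spreading_family :: "nat set set \<Rightarrow> bool" where
  "spreading_family \<F> \<longleftrightarrow>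
     (\<forall>F\<in>\<F>. finite F \<and> (\<forall>m\<in>F. 1 \<le> m)) \<and> (\<forall>m\<ge>1. {m} \<in> \<F>) \<and>
     (\<forall>F\<in>\<F>. \<forall>H\<subseteq>F. \<forall>\<mu>. strict_mono_on H \<mu> \<and> (\<forall>m\<in>H. m \<le> \<mu> m) \<longrightarrow> \<mu> ` H \<in> \<F>)"

lemma spreading_familyD:
  assumes "spreading_family \<F>"
  shows "F \<in> \<F> \<Longrightarrow> finite F" "F \<in> \<F> \<Longrightarrow> m \<in> F \<Longrightarrow> 1 \<le> m" "1 \<le> m \<Longrightarrow> {m} \<in> \<F>"
    "F \<in> \<F> \<Longrightarrow> H \<subseteq> F \<Longrightarrow> strict_mono_on H \<mu> \<Longrightarrow> (\<And>m. m \<in> H \<Longrightarrow> m \<le> \<mu> m) \<Longrightarrow> \<mu> ` H \<in> \<F>"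
  using assms unfolding spreading_family_def by blast+

lemma spreading_family_empty: "spreading_family \<F> \<Longrightarrow> {} \<in> \<F>"
  using spreading_familyD(4)[of \<F> "{1}" "{}" id] spreading_familyD(3)[of \<F> 1] by auto

text \<open>The move to the right is \<open>b\<close> composed with the inverse of \<open>a\<close>.
  The indexed form suits sets of minima and spares each use the construction of this map.\<close>

lemma spreading_family_index:
  assumes "spreading_family \<F>" "F \<in> \<F>" "a ` I \<subseteq> F" "inj_on a I"
    and "\<And>i j. i \<in> I \<Longrightarrow> j \<in> I \<Longrightarrow> a i < a j \<Longrightarrow> b i < b j" "\<And>i. i \<in> I \<Longrightarrow> a i \<le> b i"
  shows "b ` I \<in> \<F>"
proof -
  have "(\<lambda>m. b (inv_into I a m)) ` (a ` I) \<in> \<F>"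
    by (rule spreading_familyD(4)[OF assms(1-3)])
      (use assms(4-6) in \<open>auto simp: strict_mono_on_def\<close>)
  also have "(\<lambda>m. b (inv_into I a m)) ` (a ` I) = b ` I"
    using assms(4) by (auto simp: image_image)
  finally show ?thesis .
qed

lemma set_less_Min: "set_less A B \<Longrightarrow> finite A \<Longrightarrow> finite B \<Longrightarrow> A \<noteq> {} \<Longrightarrow> B \<noteq> {} \<Longrightarrow> Min A < Min B"
  by (simp add: set_less_def)

text \<open>Pairwise successive nonempty finite sets have distinct minima, so sorting by minima
  yields the increasing enumeration that \<open>fam_comp\<close> asks for, whatever the finite index
  set.\<close>

lemma fam_compI:
  fixes I :: "'i set"
  assumes fin: "finite I" and G: "\<And>i. i \<in> I \<Longrightarrow> G i \<in> \<G> \<and> finite (G i) \<and> G i \<noteq> {}"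
    and ord: "\<And>i j. i \<in> I \<Longrightarrow> j \<in> I \<Longrightarrow> i \<noteq> j \<Longrightarrow> set_less (G i) (G j) \<or> set_less (G j) (G i)"
    and mins: "(\<lambda>i. Min (G i)) ` I \<in> \<F>"
  shows "(\<Union>i\<in>I. G i) \<in> fam_comp \<F> \<G>"
proof -
  define f where "f i = Min (G i)" for i
  have lt: "set_less (G i) (G j)" if "i \<in> I" "j \<in> I" "f i < f j" for i j
    using ord[OF that(1,2)] that G set_less_Min[of "G j" "G i"] by (fastforce simp: f_def)
  have inj: "inj_on f I"
    using ord G set_less_Min by (intro inj_onI) (metis f_def less_irrefl)
  define l where "l = sorted_list_of_set (f ` I)"
  have l: "set l = f ` I" "sorted_wrt (<) l" using fin by (auto simp: l_def)
  define g where "g k = inv_into I f (l ! k)" for k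
  have g: "g k \<in> I" "f (g k) = l ! k" if "k < length l" for k
    using that l(1) nth_mem[OF that] by (auto simp: g_def inv_into_into f_inv_into_f)
  have gI: "g ` {..<length l} = I"
  proof
    show "I \<subseteq> g ` {..<length l}"
    proof
      fix i assume i: "i \<in> I"
      then obtain k where k: "k < length l" "l ! k = f i" using l(1) by (metis imageI in_set_conv_nth)
      then show "i \<in> g ` {..<length l}" using i inj by (auto simp: g_def intro!: image_eqI[of _ _ k])
    qed
  qed (use g in auto)
  have 1: "(\<Union>i\<in>I. G i) = (\<Union>k<length l. G (g k))"
    unfolding gI[symmetric] by simp
  have 2: "\<forall>k<length l. G (g k) \<in> \<G> \<and> G (g k) \<noteq> {}" using g G by blast
  have 3: "\<forall>i j. i < j \<and> j < length l \<longrightarrow> set_less (G (g i)) (G (g j))"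
    using g l(2) by (auto intro!: lt simp: sorted_wrt_iff_nth_less)
  have 4: "(\<lambda>k. Min (G (g k))) ` {..<length l} \<in> \<F>"
    using mins unfolding gI[symmetric] by (simp add: image_image)
  show ?thesis
    unfolding fam_comp_def mem_Collect_eq using 1 2 3 4
    by (intro exI[of _ "length l"] exI[of _ "\<lambda>k. G (g k)"] conjI)
qed

lemma fam_compE:
  assumes "X \<in> fam_comp \<F> \<G>"
  obtains k :: nat and G where "X = (\<Union>i<k. G i)" "\<And>i. i < k \<Longrightarrow> G i \<in> \<G>" "\<And>i. i < k \<Longrightarrow> G i \<noteq> {}"
    "\<And>i j. i < j \<Longrightarrow> j < k \<Longrightarrow> set_less (G i) (G j)" "(\<lambda>i. Min (G i)) ` {..<k} \<in> \<F>"
  using assms unfolding fam_comp_def by (elim CollectE exE conjE) (rule that, auto)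

lemma fam_comp_mono:
  assumes "\<F> \<subseteq> \<F>'" "\<G> \<subseteq> \<G>'"
  shows "fam_comp \<F> \<G> \<subseteq> fam_comp \<F>' \<G>'"
proof
  fix X assume "X \<in> fam_comp \<F> \<G>"
  then obtain k :: nat and G where X: "X = (\<Union>i<k. G i)" "\<forall>i j. i < j \<and> j < k \<longrightarrow> set_less (G i) (G j)"
    and G: "\<forall>i<k. G i \<in> \<G> \<and> G i \<noteq> {}" and mins: "(\<lambda>i. Min (G i)) ` {..<k} \<in> \<F>"
    unfolding fam_comp_def by blast
  have "\<forall>i<k. G i \<in> \<G>' \<and> G i \<noteq> {}" "(\<lambda>i. Min (G i)) ` {..<k} \<in> \<F>'"
    using G mins assms by auto
  with X show "X \<in> fam_comp \<F>' \<G>'"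
    unfolding fam_comp_def by (intro CollectI exI[of _ k] exI[of _ G]) simp
qed

text \<open>A nonempty set is a union of one block, whose minimum forms a singleton in
  \<open>\<F>\<close>; the empty set is the union of no blocks.\<close>

lemma fam_comp_single:
  assumes "spreading_family \<F>" "spreading_family \<G>"
  shows "\<G> \<subseteq> fam_comp \<F> \<G>"
proof
  fix X assume X: "X \<in> \<G>"
  have fin: "finite X" using X assms spreading_familyD(1) by blast
  show "X \<in> fam_comp \<F> \<G>"
  proof (cases "X = {}")
    case True
    have "(\<Union>i\<in>{}. X) \<in> fam_comp \<F> \<G>"
      by (rule fam_compI) (use assms spreading_family_empty in auto)
    then show ?thesis using True by simp
  next
    case False
    then have "1 \<le> Min X" using spreading_familyD(2)[OF assms(2) X] fin by simp
    then have "{Min X} \<in> \<F>" using spreading_familyD(3)[OF assms(1)] by simp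
    then have "(\<Union>i\<in>{0::nat}. X) \<in> fam_comp \<F> \<G>"
      by (intro fam_compI) (use X False fin in auto)
    then show ?thesis by simp
  qed
qed

lemma spreading_family_comp:
  assumes F: "spreading_family \<F>" and G: "spreading_family \<G>"
  shows "spreading_family (fam_comp \<F> \<G>)"
  unfolding spreading_family_def
proof (intro conjI ballI allI impI)
  fix X assume "X \<in> fam_comp \<F> \<G>"
  then obtain k :: nat and B where X: "X = (\<Union>i<k. B i)" and B: "\<And>i. i < k \<Longrightarrow> B i \<in> \<G>"
    using fam_compE by metis
  show "finite X" using spreading_familyD(1)[OF G] B X by auto
  fix m assume "m \<in> X"
  then show "1 \<le> m" using spreading_familyD(2)[OF G] B X by blast
next
  fix m :: nat assume "1 \<le> m"
  then show "{m} \<in> fam_comp \<F> \<G>" using fam_comp_single[OF F G] spreading_familyD(3)[OF G] by blast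
next
  fix X H and \<mu> :: "nat \<Rightarrow> nat"
  assume "X \<in> fam_comp \<F> \<G>" "H \<subseteq> X" and \<mu>: "strict_mono_on H \<mu> \<and> (\<forall>m\<in>H. m \<le> \<mu> m)"
  then obtain k :: nat and B where X: "X = (\<Union>i<k. B i)"
    and B: "\<And>i. i < k \<Longrightarrow> B i \<in> \<G>" "\<And>i. i < k \<Longrightarrow> B i \<noteq> {}"
    and ord: "\<And>i j. i < j \<Longrightarrow> j < k \<Longrightarrow> set_less (B i) (B j)"
    and mins: "(\<lambda>i. Min (B i)) ` {..<k} \<in> \<F>"
    by (auto elim: fam_compE)
  have fin: "finite (B i)" if "i < k" for i using B(1) that spreading_familyD(1)[OF G] by blast
  \<comment> \<open>Pieces that miss \<open>H\<close> disappear, which heredity of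
    \<open>\<F>\<close> permits; the minima of the others only move to the right.\<close>
  define I where "I = {i\<in>{..<k}. H \<inter> B i \<noteq> {}}"
  define C where "C i = \<mu> ` (H \<inter> B i)" for i
  have I: "i < k" "finite (C i)" "C i \<noteq> {}" if "i \<in> I" for i using that fin by (auto simp: I_def C_def)
  have ordC: "set_less (C i) (C j)" if "i < j" "j < k" for i j
    using ord[OF that] \<mu> by (auto simp: set_less_def C_def strict_mono_on_def)
  have minsC: "(\<lambda>i. Min (C i)) ` I \<in> \<F>"
  proof (rule spreading_family_index[OF F mins, of "\<lambda>i. Min (B i)"])
    have less: "Min (B i) < Min (B j)" if "i < j" "j < k" for i j
      using set_less_Min[OF ord[OF that]] fin B(2) that by auto
    show "inj_on (\<lambda>i. Min (B i)) I"
      using less I(1) by (intro inj_onI) (metis less_irrefl nat_neq_iff)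
    show "Min (C i) < Min (C j)" if "i \<in> I" "j \<in> I" "Min (B i) < Min (B j)" for i j
    proof -
      have "i < j" using less[of j i] that I(1) by (metis less_irrefl nat_neq_iff order_less_trans)
      then show ?thesis using ordC I that by (intro set_less_Min) auto
    qed
    show "Min (B i) \<le> Min (C i)" if i: "i \<in> I" for i
    proof -
      obtain x where x: "x \<in> H" "x \<in> B i" "Min (C i) = \<mu> x"
        using Min_in[OF I(2,3)[OF i]] by (auto simp: C_def)
      then have "Min (B i) \<le> x" using fin I(1)[OF i] by auto
      also have "x \<le> \<mu> x" using \<mu> x by blast
      finally show ?thesis using x by simp
    qed
  qed (use I in auto)
  have CG: "C i \<in> \<G>" if "i < k" for i
    unfolding C_def using \<mu> by (intro spreading_familyD(4)[OF G B(1)[OF that]]) (auto simp: strict_mono_on_def)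
  have "(\<Union>i\<in>I. C i) \<in> fam_comp \<F> \<G>"
  proof (rule fam_compI)
    show "finite I" by (simp add: I_def)
    show "set_less (C i) (C j) \<or> set_less (C j) (C i)" if "i \<in> I" "j \<in> I" "i \<noteq> j" for i j
      using ordC[of i j] ordC[of j i] I(1)[OF that(1)] I(1)[OF that(2)] that(3)
      by (cases i j rule: linorder_cases) auto
  qed (use CG I minsC in auto)
  moreover have "H = (\<Union>i\<in>I. H \<inter> B i)" using \<open>H \<subseteq> X\<close> unfolding X I_def by blast
  then have "\<mu> ` H = (\<Union>i\<in>I. C i)" unfolding C_def by (subst image_UN[symmetric]) simp
  ultimately show "\<mu> ` H \<in> fam_comp \<F> \<G>" by simp
qed

text \<open>The minima of the inner blocks of \<open>A i\<close> form a set \<open>m i\<close> of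
  \<open>\<G>\<close> with the same minimum as \<open>A i\<close>. Hence the union of the
  \<open>m i\<close> lies in \<open>fam_comp \<F> \<G>\<close>, and it is the set of minima of all
  inner blocks.\<close>

lemma fam_comp_assoc:
  assumes F: "spreading_family \<F>" and G: "spreading_family \<G>" and H: "spreading_family \<H>"
  shows "fam_comp \<F> (fam_comp \<G> \<H>) \<subseteq> fam_comp (fam_comp \<F> \<G>) \<H>"
proof
  fix X assume "X \<in> fam_comp \<F> (fam_comp \<G> \<H>)"
  then obtain k :: nat and A where X: "X = (\<Union>i<k. A i)"
    and A: "\<And>i. i < k \<Longrightarrow> A i \<in> fam_comp \<G> \<H>" "\<And>i. i < k \<Longrightarrow> A i \<noteq> {}"
    and ord: "\<And>i j. i < j \<Longrightarrow> j < k \<Longrightarrow> set_less (A i) (A j)"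
    and mins: "(\<lambda>i. Min (A i)) ` {..<k} \<in> \<F>"
    by (auto elim: fam_compE)
  define P where "P i l B \<longleftrightarrow> A i = (\<Union>j<l. B j) \<and> (\<forall>j<l. B j \<in> \<H> \<and> B j \<noteq> {}) \<and>
      (\<forall>j j'. j < j' \<and> j' < l \<longrightarrow> set_less (B j) (B j')) \<and> (\<lambda>j. Min (B j)) ` {..<l} \<in> \<G>"
    for i and l :: nat and B
  have "\<exists>l B. P i l B" if "i < k" for i
    using A(1)[OF that] unfolding fam_comp_def mem_Collect_eq P_def .
  then obtain l B where P: "\<And>i. i < k \<Longrightarrow> P i (l i) (B i)" by metis
  have B: "\<And>i. i < k \<Longrightarrow> A i = (\<Union>j<l i. B i j)"
      "\<And>i j. i < k \<Longrightarrow> j < l i \<Longrightarrow> B i j \<in> \<H> \<and> B i j \<noteq> {}"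
      "\<And>i j j'. i < k \<Longrightarrow> j < j' \<Longrightarrow> j' < l i \<Longrightarrow> set_less (B i j) (B i j')"
      "\<And>i. i < k \<Longrightarrow> (\<lambda>j. Min (B i j)) ` {..<l i} \<in> \<G>"
    using P unfolding P_def by blast+
  have fin: "finite (B i j)" if "i < k" "j < l i" for i j
    using B(2)[OF that] spreading_familyD(1)[OF H] by blast
  have finA: "finite (A i)" if "i < k" for i using fin B(1) that by auto
  define m where "m i = (\<lambda>j. Min (B i j)) ` {..<l i}" for i
  have m: "m i \<noteq> {}" "finite (m i)" "m i \<subseteq> A i" "Min (m i) = Min (A i)" if i: "i < k" for i
  proof -
    show ne: "m i \<noteq> {}" using A(2)[OF i] B(1)[OF i] by (auto simp: m_def)
    show finm: "finite (m i)" by (simp add: m_def)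
    show sub: "m i \<subseteq> A i" using B(1,2) fin i by (fastforce simp: m_def intro: Min_in)
    obtain j where j: "j < l i" "Min (A i) \<in> B i j" using Min_in[OF finA[OF i] A(2)[OF i]] B(1)[OF i] by auto
    have "Min (m i) \<le> Min (B i j)" using j finm by (auto simp: m_def)
    also have "\<dots> \<le> Min (A i)" using j fin i by auto
    finally show "Min (m i) = Min (A i)"
      using Min_antimono[OF sub ne finA[OF i]] by simp
  qed
  have "(\<Union>i<k. m i) \<in> fam_comp \<F> \<G>"
  proof (rule fam_compI)
    fix i assume "i \<in> {..<k}"
    then show "m i \<in> \<G> \<and> finite (m i) \<and> m i \<noteq> {}" using m B(4) by (auto simp: m_def)
  next
    have *: "set_less (m i) (m j)" if "i < j" "j < k" for i j
      using ord[OF that] m(3)[of i] m(3)[of j] that by (auto simp: set_less_def)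
    fix i j assume "i \<in> {..<k}" "j \<in> {..<k}" "i \<noteq> j"
    then show "set_less (m i) (m j) \<or> set_less (m j) (m i)"
      using *[of i j] *[of j i] by (cases i j rule: linorder_cases) auto
  next
    show "(\<lambda>i. Min (m i)) ` {..<k} \<in> \<F>" using mins m(4) by (simp cong: image_cong_simp)
  qed simp
  moreover have "(\<Union>i<k. m i) = (\<lambda>(i, j). Min (B i j)) ` (SIGMA i:{..<k}. {..<l i})"
    by (auto simp: m_def)
  ultimately have mm: "(\<lambda>p. Min (case p of (i, j) \<Rightarrow> B i j)) ` (SIGMA i:{..<k}. {..<l i}) \<in> fam_comp \<F> \<G>"
    by (simp add: case_prod_unfold)
  have less: "set_less (B i j) (B i' j')" if "i < i'" "i' < k" "j < l i" "j' < l i'" for i j i' j'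
  proof -
    have "B i j \<subseteq> A i" "B i' j' \<subseteq> A i'" using B(1)[of i] B(1)[of i'] that by auto
    then show ?thesis using ord[OF that(1,2)] unfolding set_less_def by blast
  qed
  have "(\<Union>p\<in>(SIGMA i:{..<k}. {..<l i}). case p of (i, j) \<Rightarrow> B i j) \<in> fam_comp (fam_comp \<F> \<G>) \<H>"
  proof (rule fam_compI[OF _ _ _ mm])
    fix p p' assume "p \<in> (SIGMA i:{..<k}. {..<l i})" "p' \<in> (SIGMA i:{..<k}. {..<l i})" "p \<noteq> p'"
    then obtain i j i' j' where p: "p = (i, j)" "p' = (i', j')" "i < k" "j < l i" "i' < k" "j' < l i'"
      "i \<noteq> i' \<or> j \<noteq> j'" by auto
    then show "set_less (case p of (i, j) \<Rightarrow> B i j) (case p' of (i, j) \<Rightarrow> B i j) \<or>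
        set_less (case p' of (i, j) \<Rightarrow> B i j) (case p of (i, j) \<Rightarrow> B i j)"
      using less[of i i' j j'] less[of i' i j' j] B(3)[of i j j'] B(3)[of i j' j]
      by (cases i i' rule: linorder_cases; cases j j' rule: linorder_cases) auto
  qed (use fin B(2) in auto)
  also have "(\<Union>p\<in>(SIGMA i:{..<k}. {..<l i}). case p of (i, j) \<Rightarrow> B i j) = X"
    using B(1) X by auto
  finally show "X \<in> fam_comp (fam_comp \<F> \<G>) \<H>" .
qed

section \<open>The Schreier classes are hereditary and spreading\<close>

lemma spreading_family_schreier_zero: "spreading_family schreier_zero"
  unfolding spreading_family_def schreier_zero_def
proof (intro conjI ballI allI impI)
  fix F H and \<mu> :: "nat \<Rightarrow> nat"
  assume F: "F \<in> {{n} | n. n \<ge> 1} \<union> {{}}" "H \<subseteq> F" and \<mu>: "strict_mono_on H \<mu> \<and> (\<forall>m\<in>H. m \<le> \<mu> m)"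
  then consider "H = {}" | n where "H = {n}" "n \<ge> 1" by blast
  then show "\<mu> ` H \<in> {{n} | n. n \<ge> 1} \<union> {{}}"
    using \<mu> by cases auto
qed auto

text \<open>Moving to the right cannot lower the minimum, while passing to the image of a subset
  cannot raise the cardinality.\<close>

lemma spreading_family_schreier_one: "spreading_family schreier_one"
  unfolding spreading_family_def
proof (intro conjI ballI allI impI)
  fix F H and \<mu> :: "nat \<Rightarrow> nat"
  assume F: "F \<in> schreier_one" "H \<subseteq> F" and \<mu>: "strict_mono_on H \<mu> \<and> (\<forall>m\<in>H. m \<le> \<mu> m)"
  show "\<mu> ` H \<in> schreier_one"
  proof (cases "H = {}")
    case False
    then have F': "finite F" "F \<noteq> {}" "1 \<le> Min F" "card F \<le> Min F"
      using F by (auto simp: schreier_one_def)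
    have fin: "finite H" using F F' finite_subset by blast
    obtain x where x: "x \<in> H" "Min (\<mu> ` H) = \<mu> x" using Min_in[of "\<mu> ` H"] fin False by fastforce
    have "Min F \<le> x" using F F' x by auto
    also have "\<dots> \<le> Min (\<mu> ` H)" using \<mu> x by auto
    finally have le: "Min F \<le> Min (\<mu> ` H)" .
    have "card (\<mu> ` H) \<le> card F"
      using card_image_le[OF fin, of \<mu>] card_mono[OF F'(1) F(2)] by linarith
    then have "1 \<le> Min (\<mu> ` H)" "card (\<mu> ` H) \<le> Min (\<mu> ` H)" using le F' by linarith+
    then show ?thesis using fin False unfolding schreier_one_def by blast
  qed (simp add: schreier_one_def)
next
  fix F m assume "F \<in> schreier_one" "m \<in> F"
  then show "1 \<le> m" unfolding schreier_one_def using Min_le order_trans by blast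
qed (auto simp: schreier_one_def)

lemma spreading_family_schreier:
  assumes e: "fundamental_system e"
  shows "spreading_family (schreier e \<alpha>)"
proof (induction \<alpha> rule: less_induct)
  case (less \<alpha>)
  consider "zero_ord \<alpha>" | \<beta> where "succ_of \<beta> \<alpha>" | "limit_ord \<alpha>" unfolding limit_ord_def by blast
  then show ?case
  proof cases
    case 1
    then show ?thesis by (simp add: schreier_zero spreading_family_schreier_zero)
  next
    case 2
    then have "\<beta> < \<alpha>" by (simp add: succ_of_def)
    with 2 show ?thesis
      by (simp add: schreier_succ spreading_family_comp spreading_family_schreier_one less)
  next
    case 3
    have IH: "spreading_family (schreier e (e \<alpha> n))" if "n \<ge> 1" for n
      using e 3 that less by (simp add: fundamental_system_def)
    show ?thesis
      unfolding spreading_family_def schreier_limit[OF e 3]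
    proof (intro conjI ballI allI impI)
      fix F assume "F \<in> {F. \<exists>n\<ge>1. F \<in> schreier e (e \<alpha> n) \<and> (\<forall>m\<in>F. n \<le> m)}"
      then obtain n where n: "n \<ge> 1" "F \<in> schreier e (e \<alpha> n)" "\<forall>m\<in>F. n \<le> m" by blast
      show "finite F" using spreading_familyD(1)[OF IH] n by blast
      show "1 \<le> m" if "m \<in> F" for m using that n by force
      fix H and \<mu> :: "nat \<Rightarrow> nat"
      assume H: "H \<subseteq> F" and \<mu>: "strict_mono_on H \<mu> \<and> (\<forall>m\<in>H. m \<le> \<mu> m)"
      have "\<mu> ` H \<in> schreier e (e \<alpha> n)"
        using spreading_familyD(4)[OF IH[OF n(1)] n(2) H] \<mu> by blast
      \<comment> \<open>The threshold of the limit stage survives a move to the right, so the same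
        \<open>n\<close> serves.\<close>
      moreover have "\<forall>m\<in>\<mu> ` H. n \<le> m" using n(3) H \<mu> by (auto intro: order_trans)
      ultimately show "\<mu> ` H \<in> {F. \<exists>n\<ge>1. F \<in> schreier e (e \<alpha> n) \<and> (\<forall>m\<in>F. n \<le> m)}"
        using n(1) by blast
    next
      fix m :: nat assume "1 \<le> m"
      then show "{m} \<in> {F. \<exists>n\<ge>1. F \<in> schreier e (e \<alpha> n) \<and> (\<forall>m\<in>F. n \<le> m)}"
        using spreading_familyD(3)[OF IH[of 1]] by auto
    qed
  qed
qed

text \<open>Starting from the singletons gives a meaning to the exponent 0, from which the
  inductions and the chain of norms begin.\<close>

definition fam_iter :: "nat set set \<Rightarrow> nat \<Rightarrow> nat set set" where
  "fam_iter \<F> j = (fam_comp \<F> ^^ j) schreier_zero"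

lemma fam_iter_0 [simp]: "fam_iter \<F> 0 = schreier_zero"
  and fam_iter_Suc [simp]: "fam_iter \<F> (Suc j) = fam_comp \<F> (fam_iter \<F> j)"
  by (simp_all add: fam_iter_def)

lemma spreading_family_iter: "spreading_family \<F> \<Longrightarrow> spreading_family (fam_iter \<F> j)"
  by (induction j) (simp_all add: spreading_family_schreier_zero spreading_family_comp)

lemma spreading_family_power: "spreading_family \<F> \<Longrightarrow> spreading_family (fam_power \<F> n)"
proof -
  assume "spreading_family \<F>"
  then have "spreading_family ((fam_comp \<F> ^^ k) \<F>)" for k
    by (induction k) (simp_all add: spreading_family_comp)
  then show ?thesis by (simp add: fam_power_def)
qed

lemma fam_iter_mono:
  assumes "spreading_family \<F>" "i \<le> j"
  shows "fam_iter \<F> i \<subseteq> fam_iter \<F> j"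
  by (rule lift_Suc_mono_le[OF _ assms(2)])
    (simp add: fam_comp_single assms(1) spreading_family_iter)

text \<open>Nonempty blocks from \<open>schreier_zero\<close> are singletons, so composing
  \<open>\<F>\<close> with it yields only sets of \<open>\<F>\<close>. A lower estimate for the
  power thus passes to the iterate.\<close>

lemma fam_iter_subset_power:
  assumes "n \<ge> 1"
  shows "fam_iter \<F> n \<subseteq> fam_power \<F> n"
proof -
  have comp: "fam_comp \<F> schreier_zero \<subseteq> \<F>"
  proof
    fix X assume "X \<in> fam_comp \<F> schreier_zero"
    then obtain k :: nat and G where X: "X = (\<Union>i<k. G i)"
      and G: "\<forall>i<k. G i \<in> schreier_zero \<and> G i \<noteq> {}" and mins: "(\<lambda>i. Min (G i)) ` {..<k} \<in> \<F>"
      unfolding fam_comp_def by blast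
    have "G i = {Min (G i)}" if "i < k" for i
      using G that by (auto simp: schreier_zero_def)
    then have "X = (\<lambda>i. Min (G i)) ` {..<k}" unfolding X by blast
    then show "X \<in> \<F>" using mins by simp
  qed
  have "fam_iter \<F> (Suc k) \<subseteq> (fam_comp \<F> ^^ k) \<F>" for k
  proof (induction k)
    case 0
    show ?case using comp by simp
  next
    case (Suc k)
    show ?case using fam_comp_mono[OF order_refl Suc.IH] by simp
  qed
  from this[of "n - 1"] show ?thesis using assms by (simp add: fam_power_def del: fam_iter_Suc)
qed

text \<open>Associativity merges each further outer factor into the left component. This is what
  allows estimates for \<open>i\<close> and for \<open>j\<close> levels to be multiplied.\<close>

lemma fam_iter_add:
  assumes "spreading_family \<F>"
  shows "fam_iter \<F> (i + j) \<subseteq> fam_comp (fam_iter \<F> i) (fam_iter \<F> j)"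
proof (induction i)
  case 0
  show ?case using fam_comp_single spreading_family_schreier_zero spreading_family_iter[OF assms] by simp
next
  case (Suc i)
  have "fam_iter \<F> (Suc i + j) \<subseteq> fam_comp \<F> (fam_comp (fam_iter \<F> i) (fam_iter \<F> j))"
    using fam_comp_mono[OF order_refl Suc] by simp
  also have "\<dots> \<subseteq> fam_comp (fam_comp \<F> (fam_iter \<F> i)) (fam_iter \<F> j)"
    by (intro fam_comp_assoc spreading_family_iter assms)
  finally show ?case by simp
qed


section \<open>Lower estimates\<close>

text \<open>
  The 0-based indices of the basis vectors whose positions lie between \<open>m\<close> and the next element of
  \<open>F\<close>. A block sequence is indexed below by the set \<open>F\<close> itself, with the block at \<open>m\<close> supported
  in \<open>gap F m\<close>; this avoids renumbering when passing to subfamilies.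
\<close>

definition gap :: "nat set \<Rightarrow> nat \<Rightarrow> nat set" where
  "gap F m = {i. m \<le> Suc i \<and> (\<forall>m'\<in>F. m < m' \<longrightarrow> Suc i < m')}"

text \<open>\<open>r m\<close> is the right end of the interval that starts at \<open>m\<close>; a
  value below \<open>m\<close> encodes an empty interval.\<close>

definition separated :: "nat set \<Rightarrow> (nat \<Rightarrow> nat) \<Rightarrow> bool" where
  "separated F r \<longleftrightarrow> (\<forall>m\<in>F. \<forall>m'\<in>F. m < m' \<longrightarrow> r m < m')"

text \<open>The supremum defining \<open>delta\<close> satisfies the estimate itself: when the sum
  of norms is positive, every competitor is at most the quotient of the two sides.\<close>

lemma delta_admissible:
  assumes N: "\<And>v. 0 \<le> N v" and z: "admissible \<F> k z x"
  shows "delta \<F> N x * (\<Sum>i<k. N (z i)) \<le> N (\<Sum>i<k. z i)"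
proof (cases "(\<Sum>i<k. N (z i)) = 0")
  case False
  then have pos: "0 < (\<Sum>i<k. N (z i))" using N by (simp add: order_less_le sum_nonneg)
  have "delta \<F> N x \<le> N (\<Sum>i<k. z i) / (\<Sum>i<k. N (z i))"
    unfolding delta_def
  proof (rule cSup_least)
    show "{d. 0 \<le> d \<and> (\<forall>k z. admissible \<F> k z x \<longrightarrow> d * (\<Sum>i<k. N (z i)) \<le> N (\<Sum>i<k. z i))} \<noteq> {}"
      using N by (auto intro!: exI[of _ 0])
  qed (use z pos in \<open>auto simp: pos_le_divide_eq\<close>)
  then show ?thesis using pos by (simp add: pos_le_divide_eq)
qed (simp add: N)

lemma sum_cSup_le:
  fixes A :: "'i \<Rightarrow> real set"
  assumes "finite I" "\<And>i. i \<in> I \<Longrightarrow> A i \<noteq> {}" "\<And>i. i \<in> I \<Longrightarrow> bdd_above (A i)"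
    and le: "\<And>s. (\<And>i. i \<in> I \<Longrightarrow> s i \<in> A i) \<Longrightarrow> sum s I \<le> c"
  shows "(\<Sum>i\<in>I. Sup (A i)) \<le> c"
proof (rule field_le_epsilon)
  fix d :: real assume d: "d > 0"
  \<comment> \<open>The error \<open>d\<close> is shared among the indices; the summand 1 covers an
    empty \<open>I\<close>.\<close>
  define \<eta> where "\<eta> = d / (real (card I) + 1)"
  have \<eta>: "\<eta> > 0" using d by (simp add: \<eta>_def)
  have "\<exists>x\<in>A i. Sup (A i) - \<eta> < x" if "i \<in> I" for i
    using assms(2,3)[OF that] \<eta> by (subst less_cSup_iff[symmetric]) auto
  then obtain s where s: "\<And>i. i \<in> I \<Longrightarrow> s i \<in> A i" "\<And>i. i \<in> I \<Longrightarrow> Sup (A i) - \<eta> < s i" by metis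
  have "(\<Sum>i\<in>I. Sup (A i)) \<le> (\<Sum>i\<in>I. s i + \<eta>)"
    using s(2) by (intro sum_mono) (simp add: diff_less_eq less_imp_le)
  also have "\<dots> = sum s I + card I * \<eta>" by (simp add: sum.distrib)
  also have "\<dots> \<le> c + d"
  proof (rule add_mono)
    show "sum s I \<le> c" using s(1) by (rule le)
    show "card I * \<eta> \<le> d" using d by (simp add: \<eta>_def pos_divide_le_eq algebra_simps)
  qed
  finally show "(\<Sum>i\<in>I. Sup (A i)) \<le> c + d" .
qed

context basis_seq
begin

lemma coef_eqI: "(\<And>i. coef v i = coef w i) \<Longrightarrow> v = w"
  using coef_eq_0_iff[of "v - w"] by (simp add: coef_diff)

lemma supp_span:
  assumes "v \<in> span (y ` B)"
  shows "supp y v = Suc ` {i. coef v i \<noteq> 0}" "finite (supp y v)" "supp y v \<subseteq> Suc ` B"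
    "supp y v = {} \<longleftrightarrow> v = 0"
proof -
  have "v \<in> span (range y)" using assms span_mono[of "y ` B" "range y"] by auto
  then show s: "supp y v = Suc ` {i. coef v i \<noteq> 0}" by (auto simp: supp_coef)
  show "finite (supp y v)" "supp y v \<subseteq> Suc ` B"
    unfolding s using span_coef[OF assms] by auto
  show "supp y v = {} \<longleftrightarrow> v = 0" unfolding s using coef_eq_0_iff[of v] by auto
qed

lemma supp_basis: "supp y (y i) = {Suc i}"
  using supp_span(1)[of "y i" UNIV] by (auto simp: coef_basis span_base)

text \<open>A variant of the estimate behind \<open>delta\<close> in which blocks may vanish and
  \<open>m\<close> only bounds the support of its block from below.\<close>

definition lower_est :: "nat set set \<Rightarrow> real \<Rightarrow> bool" where
  "lower_est \<F> c \<longleftrightarrow> (\<forall>F\<in>\<F>. \<forall>z. (\<forall>m\<in>F. z m \<in> span (y ` gap F m)) \<longrightarrow>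
     c * (\<Sum>m\<in>F. norm (z m)) \<le> norm (\<Sum>m\<in>F. z m))"

text \<open>Dropping the zero blocks and replacing each \<open>m\<close> by the least support point
  of its block moves a subset of \<open>F\<close> to the right, so the nonzero blocks are
  admissible.\<close>

lemma lower_est_delta:
  assumes F: "spreading_family \<F>"
  shows "lower_est \<F> (delta \<F> norm y)"
  unfolding lower_est_def
proof (intro ballI allI impI)
  fix F and z :: "nat \<Rightarrow> 'a"
  assume FF: "F \<in> \<F>" and z: "\<forall>m\<in>F. z m \<in> span (y ` gap F m)"
  have fin: "finite F" using FF F spreading_familyD(1) by blast
  define H where "H = {m\<in>F. z m \<noteq> 0}"
  define l where "l = sorted_list_of_set H"
  have l: "set l = H" "sorted_wrt (<) l" "distinct l" using fin by (auto simp: l_def H_def)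
  have lH: "l ! i \<in> H" if "i < length l" for i using that l(1) nth_mem by blast
  have bij: "bij_betw (\<lambda>i. l ! i) {..<length l} H"
    using bij_betw_nth[OF l(3) _ refl] l(1) by simp
  have im: "f ` H = (\<lambda>i. f (l ! i)) ` {..<length l}" for f :: "nat \<Rightarrow> nat"
    using bij by (simp add: bij_betw_def image_image[symmetric])
  have S: "finite (supp y (z m))" "supp y (z m) \<subseteq> Suc ` gap F m" "supp y (z m) \<noteq> {}" if "m \<in> H" for m
    using that z supp_span[of "z m" "gap F m"] by (auto simp: H_def)
  have bound: "m \<le> s" "m' \<in> F \<Longrightarrow> m < m' \<Longrightarrow> s < m'" if "m \<in> H" "s \<in> supp y (z m)" for m m' s
    using S(2)[OF that(1)] that(2) by (auto simp: gap_def)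
  have "admissible \<F> (length l) (\<lambda>i. z (l ! i)) y"
    unfolding admissible_def block_seq_on_def
  proof (intro conjI ballI impI)
    fix i assume "i \<in> {..<length l}"
    then have "l ! i \<in> H" using lH by simp
    then show "z (l ! i) \<in> span (range y)" "z (l ! i) \<noteq> 0"
      using z span_mono[of "y ` gap F (l ! i)" "range y"] by (auto simp: H_def)
  next
    fix i j assume "i \<in> {..<length l}" "j \<in> {..<length l}" "i < j"
    then have "l ! i \<in> H" "l ! j \<in> H" "l ! i < l ! j"
      using lH l(2) by (auto simp: sorted_wrt_iff_nth_less)
    then show "set_less (supp y (z (l ! i))) (supp y (z (l ! j)))"
      unfolding set_less_def using bound by (fastforce simp: H_def)
  next
    have "(\<lambda>m. Min (supp y (z m))) ` H \<in> \<F>"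
    proof (rule spreading_familyD(4)[OF F FF])
      show "strict_mono_on H (\<lambda>m. Min (supp y (z m)))"
      proof (rule strict_mono_onI)
        fix m m' assume m: "m \<in> H" "m' \<in> H" "m < m'"
        have "Min (supp y (z m)) < m'"
          using bound(2)[OF m(1) Min_in] S m by (auto simp: H_def)
        also have "m' \<le> Min (supp y (z m'))" using bound(1)[OF m(2) Min_in] S m by auto
        finally show "Min (supp y (z m)) < Min (supp y (z m'))" .
      qed
      show "m \<le> Min (supp y (z m))" if "m \<in> H" for m
        using bound(1)[OF that Min_in] S that by auto
    qed (auto simp: H_def)
    then show "(\<lambda>i. Min (supp y (z (l ! i)))) ` {..<length l} \<in> \<F>" by (simp add: im)
  qed
  then have "delta \<F> norm y * (\<Sum>i<length l. norm (z (l ! i))) \<le> norm (\<Sum>i<length l. z (l ! i))"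
    by (intro delta_admissible) auto
  moreover have "(\<Sum>i<length l. norm (z (l ! i))) = (\<Sum>m\<in>H. norm (z m))"
    using sum.reindex_bij_betw[OF bij, of "\<lambda>m. norm (z m)"] by simp
  moreover have "(\<Sum>m\<in>H. norm (z m)) = (\<Sum>m\<in>F. norm (z m))"
    using fin by (intro sum.mono_neutral_left) (auto simp: H_def)
  moreover have "(\<Sum>i<length l. z (l ! i)) = (\<Sum>m\<in>H. z m)"
    using sum.reindex_bij_betw[OF bij, of z] by simp
  moreover have "(\<Sum>m\<in>H. z m) = (\<Sum>m\<in>F. z m)"
    using fin by (intro sum.mono_neutral_left) (auto simp: H_def)
  ultimately show "delta \<F> norm y * (\<Sum>m\<in>F. norm (z m)) \<le> norm (\<Sum>m\<in>F. z m)" by simp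
qed

lemma lower_est_antimono: "lower_est \<F> c \<Longrightarrow> \<G> \<subseteq> \<F> \<Longrightarrow> lower_est \<G> c"
  unfolding lower_est_def by blast

text \<open>The constant \<open>d\<close> is used inside each piece and \<open>c\<close> for the
  sums over the pieces, which are again blocks, indexed by the minima of the pieces.\<close>

lemma lower_est_comp:
  assumes c: "lower_est \<F> c" "c \<ge> 0" and d: "lower_est \<G> d" and G: "spreading_family \<G>"
  shows "lower_est (fam_comp \<F> \<G>) (c * d)"
  unfolding lower_est_def
proof (intro ballI allI impI)
  fix X and z :: "nat \<Rightarrow> 'a"
  assume "X \<in> fam_comp \<F> \<G>" and z: "\<forall>m\<in>X. z m \<in> span (y ` gap X m)"
  then obtain k :: nat and B where X: "X = (\<Union>i<k. B i)"
    and B: "\<And>i. i < k \<Longrightarrow> B i \<in> \<G>" "\<And>i. i < k \<Longrightarrow> B i \<noteq> {}"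
    and ord: "\<And>i j. i < j \<Longrightarrow> j < k \<Longrightarrow> set_less (B i) (B j)"
    and mins: "(\<lambda>i. Min (B i)) ` {..<k} \<in> \<F>"
    by (auto elim: fam_compE)
  have fin: "finite (B i)" if "i < k" for i using B(1)[OF that] G spreading_familyD(1) by blast
  have less: "Min (B i) < Min (B j)" if "i < j" "j < k" for i j
    using set_less_Min[OF ord[OF that]] fin B(2) that by auto
  have inj: "inj_on (\<lambda>i. Min (B i)) {..<k}"
    using less by (intro linorder_inj_onI) (auto simp: order_less_imp_not_eq)
  have disj: "B i \<inter> B j = {}" if "i < k" "j < k" "i \<noteq> j" for i j
    using ord[of i j] ord[of j i] that by (cases i j rule: linorder_cases) (auto simp: set_less_def)
  define M where "M = (\<lambda>i. Min (B i)) ` {..<k}"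
  define w where "w m = (\<Sum>x\<in>B (inv_into {..<k} (\<lambda>i. Min (B i)) m). z x)" for m
  have w: "w (Min (B i)) = (\<Sum>x\<in>B i. z x)" if "i < k" for i
    unfolding w_def using inv_into_f_f[OF inj, of i] that by simp
  have sumM: "(\<Sum>m\<in>M. f m) = (\<Sum>i<k. f (Min (B i)))" for f :: "nat \<Rightarrow> 'b::comm_monoid_add"
    unfolding M_def using sum.reindex[OF inj, of f] by simp
  have sumX: "(\<Sum>x\<in>X. f x) = (\<Sum>i<k. \<Sum>x\<in>B i. f x)" for f :: "nat \<Rightarrow> 'b::comm_monoid_add"
    unfolding X using fin disj by (intro sum.UNION_disjoint) auto
  have zG: "d * (\<Sum>x\<in>B i. norm (z x)) \<le> norm (\<Sum>x\<in>B i. z x)" if i: "i < k" for i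
  proof -
    have "z m \<in> span (y ` gap (B i) m)" if m: "m \<in> B i" for m
    proof -
      \<comment> \<open>A subset of \<open>X\<close> has fewer points to end a gap, so gaps only
        grow.\<close>
      have "gap X m \<subseteq> gap (B i) m" using i by (auto simp: gap_def X)
      then show ?thesis using z span_mono[OF image_mono] m i unfolding X by blast
    qed
    then show ?thesis using d B(1)[OF i] unfolding lower_est_def by blast
  qed
  have wM: "w m \<in> span (y ` gap M m)" if "m \<in> M" for m
  proof -
    obtain i where i: "i < k" "m = Min (B i)" using \<open>m \<in> M\<close> by (auto simp: M_def)
    have "z x \<in> span (y ` gap M m)" if x: "x \<in> B i" for x
    proof -
      have "gap X x \<subseteq> gap M m"
      proof
        fix p assume p: "p \<in> gap X x"
        have "m \<le> x" using x i fin by simp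
        moreover have "Suc p < m'" if m': "m' \<in> M" "m < m'" for m'
        proof -
          obtain j where j: "j < k" "m' = Min (B j)" using m' by (auto simp: M_def)
          have "i < j" using less[of j i] m' i j by (metis less_asym less_irrefl linorder_less_linear)
          have "m' \<in> B j" using j fin B(2) by simp
          then have "x < m'" "m' \<in> X" using ord[OF \<open>i < j\<close> j(1)] x j X by (auto simp: set_less_def)
          then show ?thesis using p by (simp add: gap_def)
        qed
        ultimately show "p \<in> gap M m" using p by (auto simp: gap_def)
      qed
      then show ?thesis using z span_mono[OF image_mono] x i(1) unfolding X by blast
    qed
    then show ?thesis using w[OF i(1)] i(2) by (simp add: span_sum)
  qed
  have "c * d * (\<Sum>x\<in>X. norm (z x)) = c * (\<Sum>i<k. d * (\<Sum>x\<in>B i. norm (z x)))"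
    by (simp add: sumX sum_distrib_left mult.assoc)
  also have "\<dots> \<le> c * (\<Sum>i<k. norm (\<Sum>x\<in>B i. z x))"
    using zG c(2) by (intro mult_left_mono sum_mono) auto
  also have "\<dots> = c * (\<Sum>m\<in>M. norm (w m))" unfolding sumM using w by simp
  also have "\<dots> \<le> norm (\<Sum>m\<in>M. w m)"
    using c(1) mins wM unfolding lower_est_def M_def by blast
  also have "(\<Sum>m\<in>M. w m) = (\<Sum>x\<in>X. z x)" unfolding sumM sumX using w by simp
  finally show "c * d * (\<Sum>x\<in>X. norm (z x)) \<le> norm (\<Sum>x\<in>X. z x)" .
qed

lemma lower_est_schreier_zero: "lower_est schreier_zero 1"
  by (auto simp: lower_est_def schreier_zero_def)

text \<open>Each induction step splits off \<open>n\<close> levels by \<open>fam_iter_add\<close>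
  and multiplies the constant by \<open>c\<close>.\<close>

lemma lower_est_iter:
  assumes S: "spreading_family S" and c: "lower_est (fam_iter S n) c" "c \<ge> 0"
  shows "lower_est (fam_iter S (n * m)) (c ^ m)"
proof (induction m)
  case 0
  show ?case by (simp add: lower_est_schreier_zero)
next
  case (Suc m)
  have "lower_est (fam_comp (fam_iter S n) (fam_iter S (n * m))) (c * c ^ m)"
    by (intro lower_est_comp c Suc spreading_family_iter S)
  then show ?case using lower_est_antimono fam_iter_add[OF S, of n "n * m"] by simp
qed

text \<open>The basis projection onto the positions \<open>m, \<dots>, r\<close>, both inclusive, for \<open>m \<ge> 1\<close>.\<close>

definition proj :: "nat \<Rightarrow> nat \<Rightarrow> 'a \<Rightarrow> 'a" where
  "proj m r v = (\<Sum>i\<in>{m - 1..<r}. coef v i *\<^sub>R y i)"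

lemma coef_proj: "coef (proj m r v) i = (if m \<le> Suc i \<and> i < r then coef v i else 0)"
  unfolding proj_def by (subst coef_finite_sum) auto

lemma proj_add: "proj m r (v + w) = proj m r v + proj m r w"
  by (simp add: proj_def coef_add scaleR_add_left sum.distrib)

lemma proj_scale: "proj m r (c *\<^sub>R v) = c *\<^sub>R proj m r v"
  by (simp add: proj_def coef_scale scaleR_sum_right)

lemma proj_in_span: "proj m r v \<in> span (y ` {i. m \<le> Suc i \<and> i < r})"
  unfolding proj_def by (intro span_sum span_scale span_base) auto

lemma coef_psum: "coef (psum n v) i = (if i < n then coef v i else 0)"
  unfolding psum_def by (subst coef_finite_sum) auto

lemma proj_one: "proj 1 r v = psum r v"
  by (rule coef_eqI) (simp add: coef_proj coef_psum)

lemma norm_proj_le: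
  assumes K: "\<And>n v. norm (psum n v) \<le> K * norm v"
  shows "norm (proj m r v) \<le> 2 * K * norm v"
proof (cases "m - 1 \<le> r")
  case True
  have "proj m r v = psum r v - psum (m - 1) v"
    using True by (intro coef_eqI) (auto simp: coef_proj coef_psum coef_diff)
  then show ?thesis
    using norm_triangle_ineq4[of "psum r v" "psum (m - 1) v"] K[of r v] K[of "m - 1" v] by simp
next
  case False
  then have "proj m r v = 0" by (simp add: proj_def)
  then show ?thesis using order_trans[OF norm_ge_zero K[of 0 v]] by simp
qed

lemma norm_proj_mono:
  assumes K: "\<And>n v. norm (psum n v) \<le> K * norm v" and "r \<le> r'"
  shows "norm (proj m r v) \<le> K * norm (proj m r' v)"
proof -
  have "proj m r v = psum r (proj m r' v)"
    using assms(2) by (intro coef_eqI) (auto simp: coef_proj coef_psum)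
  then show ?thesis using K by simp
qed

section \<open>Upper bounds for sums over separated intervals\<close>

definition psums :: "nat set \<Rightarrow> (nat \<Rightarrow> nat) \<Rightarrow> 'a \<Rightarrow> real" where
  "psums F r v = (\<Sum>m\<in>F. norm (proj m (r m) v))"

text \<open>Enlarging the intervals until they are contiguous costs a factor \<open>K\<close>. The
  lower estimate then compares the enlarged pieces with their sum, a single interval projection,
  which costs another \<open>2 * K\<close>.\<close>

lemma psums_bound:
  assumes K: "\<And>n v. norm (psum n v) \<le> K * norm v" "K \<ge> 1"
    and c: "lower_est \<F> c" "c \<ge> 0" and S: "spreading_family \<F>"
    and F: "F \<in> \<F>" and r: "separated F r"
  shows "c * psums F r v \<le> 2 * K\<^sup>2 * norm v"
proof (cases "F = {}")
  case False
  have fin: "finite F" and pos: "\<And>m. m \<in> F \<Longrightarrow> 1 \<le> m" using F S spreading_familyD by blast+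
  \<comment> \<open>\<open>R\<close> ends the last interval. Including \<open>F\<close> in the
    maximum makes it also bound the right ends that are determined by a later starting
    point.\<close>
  define R where "R = Max (r ` F \<union> F)"
  have R: "r m \<le> R" "m \<le> R" if "m \<in> F" for m using that fin by (auto simp: R_def)
  \<comment> \<open>\<open>r'\<close> extends each interval up to the next element of \<open>F\<close>, so that the intervals become contiguous\<close>
  define r' where "r' m = (if \<exists>m'\<in>F. m < m' then Min {m'\<in>F. m < m'} - 1 else R)" for m
  have r'_less: "r' m < m'" if "m \<in> F" "m' \<in> F" "m < m'" for m m'
  proof -
    have "Min {m'\<in>F. m < m'} \<le> m'" using that fin by simp
    then show ?thesis using that pos[OF that(2)] unfolding r'_def by auto
  qed
  have r'_attained: "\<exists>m'\<in>F. m < m' \<and> r' m = m' - 1" if "\<exists>m'\<in>F. m < m'" for m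
  proof -
    have "Min {m'\<in>F. m < m'} \<in> {m'\<in>F. m < m'}" using fin that by (intro Min_in) auto
    then show ?thesis using that unfolding r'_def by (intro bexI[of _ "Min {m'\<in>F. m < m'}"]) auto
  qed
  have r'_ge: "r m \<le> r' m" if "m \<in> F" for m
  proof (cases "\<exists>m'\<in>F. m < m'")
    case True
    then obtain m' where "m' \<in> F" "m < m'" "r' m = m' - 1" using r'_attained by blast
    then show ?thesis using r that unfolding separated_def by fastforce
  qed (use R that in \<open>simp add: r'_def\<close>)
  have r'_le: "r' m \<le> R" if "m \<in> F" for m
    using r'_attained[of m] R by (cases "\<exists>m'\<in>F. m < m'") (fastforce, simp add: r'_def)
  have sum_proj: "(\<Sum>m\<in>F. proj m (r' m) v) = proj (Min F) R v"
  proof -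
    have U: "(\<Union>m\<in>F. {m - 1..<r' m}) = {Min F - 1..<R}"
    proof (intro equalityI subsetI)
      fix i assume "i \<in> (\<Union>m\<in>F. {m - 1..<r' m})"
      then obtain m where m: "m \<in> F" "m - 1 \<le> i" "i < r' m" by auto
      have "Min F \<le> m" using m fin by simp
      then show "i \<in> {Min F - 1..<R}" using m r'_le[OF m(1)] by auto
    next
      fix i assume i: "i \<in> {Min F - 1..<R}"
      \<comment> \<open>The interval containing \<open>i\<close> starts at the largest element of
        \<open>F\<close> that is at most \<open>Suc i\<close>.\<close>
      define A where "A = {m\<in>F. m \<le> Suc i}"
      have "Min F \<in> A" using i fin False by (auto simp: A_def)
      then have "Max A \<in> A" using fin by (intro Max_in) (auto simp: A_def)
      then have m: "Max A \<in> F" "Max A \<le> Suc i" by (auto simp: A_def)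
      have "i < r' (Max A)"
      proof (cases "\<exists>m'\<in>F. Max A < m'")
        case True
        then obtain m' where m': "m' \<in> F" "Max A < m'" "r' (Max A) = m' - 1" using r'_attained by blast
        have "finite A" using fin by (simp add: A_def)
        then have "m' \<notin> A" using m'(2) Max_ge leD by blast
        then show ?thesis using m' by (simp add: A_def)
      next
        case False
        then have "r' (Max A) = R" by (simp add: r'_def)
        then show ?thesis using i by simp
      qed
      then show "i \<in> (\<Union>m\<in>F. {m - 1..<r' m})" using m by (intro UN_I[of "Max A"]) auto
    qed
    have "{m - 1..<r' m} \<inter> {m' - 1..<r' m'} = {}" if "m \<in> F" "m' \<in> F" "m < m'" for m m'
      using r'_less[OF that] by auto
    then have "{m - 1..<r' m} \<inter> {m' - 1..<r' m'} = {}" if "m \<in> F" "m' \<in> F" "m \<noteq> m'" for m m'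
      using that by (metis inf_commute nat_neq_iff)
    then show ?thesis
      unfolding proj_def U[symmetric] by (subst sum.UNION_disjoint) (use fin in auto)
  qed
  have in_gap: "proj m (r' m) v \<in> span (y ` gap F m)" if "m \<in> F" for m
  proof -
    have "{i. m \<le> Suc i \<and> i < r' m} \<subseteq> gap F m"
      using r'_less[OF that] by (fastforce simp: gap_def)
    then show ?thesis using proj_in_span span_mono[OF image_mono] by blast
  qed
  have "c * (\<Sum>m\<in>F. norm (proj m (r' m) v)) \<le> norm (\<Sum>m\<in>F. proj m (r' m) v)"
    using c(1)[unfolded lower_est_def, rule_format, OF F, of "\<lambda>m. proj m (r' m) v"] in_gap by simp
  also note sum_proj
  also have "norm (proj (Min F) R v) \<le> 2 * K * norm v" by (rule norm_proj_le[OF K(1)])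
  finally have 1: "c * (\<Sum>m\<in>F. norm (proj m (r' m) v)) \<le> 2 * K * norm v" .
  have "psums F r v \<le> (\<Sum>m\<in>F. K * norm (proj m (r' m) v))"
    unfolding psums_def using r'_ge by (intro sum_mono norm_proj_mono K(1))
  then have "c * psums F r v \<le> c * (\<Sum>m\<in>F. K * norm (proj m (r' m) v))"
    using c(2) by (rule mult_left_mono)
  also have "\<dots> = K * (c * (\<Sum>m\<in>F. norm (proj m (r' m) v)))" by (simp add: sum_distrib_left mult_ac)
  also have "\<dots> \<le> K * (2 * K * norm v)" using 1 K(2) by (intro mult_left_mono) auto
  finally show ?thesis by (simp add: power2_eq_square mult_ac)
qed (simp add: psums_def)

end


section \<open>The renorming\<close>

context basis_seq
begin

lemma psums_scale: "psums F r (c *\<^sub>R v) = \<bar>c\<bar> * psums F r v"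
  by (simp add: psums_def proj_scale sum_distrib_left)

lemma psums_triangle: "psums F r (v + w) \<le> psums F r v + psums F r w"
  unfolding psums_def proj_add sum.distrib[symmetric] by (intro sum_mono norm_triangle_ineq)

definition psums_set :: "nat set set \<Rightarrow> 'a \<Rightarrow> real set" where
  "psums_set \<F> v = {psums F r v | F r. F \<in> \<F> \<and> separated F r}"

text \<open>With \<open>fam_iter S j\<close> in place of \<open>\<F>\<close> this is the quantity
  written \<open>q\<^sub>j\<close> in the opening remarks.\<close>

definition fnorm :: "nat set set \<Rightarrow> 'a \<Rightarrow> real" where
  "fnorm \<F> v = Sup (psums_set \<F> v)"

text \<open>It makes the real supremum in \<open>fnorm\<close> meaningful, and its linear form in
  the norm gives the upper half of the equivalence of norms.\<close>

definition psums_bdd :: "nat set set \<Rightarrow> real \<Rightarrow> bool" where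
  "psums_bdd \<F> D \<longleftrightarrow> (\<forall>F\<in>\<F>. \<forall>r. separated F r \<longrightarrow> (\<forall>v. psums F r v \<le> D * norm v))"

lemma psums_set_bdd: "psums_bdd \<F> D \<Longrightarrow> bdd_above (psums_set \<F> v)"
  unfolding psums_bdd_def psums_set_def by (intro bdd_aboveI[of _ "D * norm v"]) auto

lemma psums_set_nonempty: "{} \<in> \<F> \<Longrightarrow> psums_set \<F> v \<noteq> {}"
  by (auto simp: psums_set_def separated_def)

lemma fnorm_upper: "psums_bdd \<F> D \<Longrightarrow> F \<in> \<F> \<Longrightarrow> separated F r \<Longrightarrow> psums F r v \<le> fnorm \<F> v"
  unfolding fnorm_def by (intro cSup_upper psums_set_bdd) (auto simp: psums_set_def)

lemma fnorm_least:
  "{} \<in> \<F> \<Longrightarrow> (\<And>F r. F \<in> \<F> \<Longrightarrow> separated F r \<Longrightarrow> psums F r v \<le> c) \<Longrightarrow> fnorm \<F> v \<le> c"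
  unfolding fnorm_def by (intro cSup_least psums_set_nonempty) (auto simp: psums_set_def)

lemma fnorm_le: "{} \<in> \<F> \<Longrightarrow> psums_bdd \<F> D \<Longrightarrow> fnorm \<F> v \<le> D * norm v"
  by (rule fnorm_least) (auto simp: psums_bdd_def)

lemma fnorm_nonneg: "{} \<in> \<F> \<Longrightarrow> psums_bdd \<F> D \<Longrightarrow> 0 \<le> fnorm \<F> v"
  using fnorm_upper[of \<F> D "{}" id v] by (simp add: separated_def psums_def)

lemma fnorm_triangle:
  assumes "{} \<in> \<F>" "psums_bdd \<F> D"
  shows "fnorm \<F> (v + w) \<le> fnorm \<F> v + fnorm \<F> w"
  using assms(1)
proof (rule fnorm_least)
  fix F r assume F: "F \<in> \<F>" "separated F r"
  have "psums F r (v + w) \<le> psums F r v + psums F r w" by (rule psums_triangle)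
  also have "\<dots> \<le> fnorm \<F> v + fnorm \<F> w" using assms(2) F by (intro add_mono fnorm_upper)
  finally show "psums F r (v + w) \<le> fnorm \<F> v + fnorm \<F> w" .
qed

text \<open>One inequality is termwise; applied again to \<open>inverse c\<close> it gives its own
  converse.\<close>

lemma fnorm_scale:
  assumes "{} \<in> \<F>" "psums_bdd \<F> D"
  shows "fnorm \<F> (c *\<^sub>R v) = \<bar>c\<bar> * fnorm \<F> v"
proof -
  have le: "fnorm \<F> (c *\<^sub>R v) \<le> \<bar>c\<bar> * fnorm \<F> v" for c v
    using assms(1) by (rule fnorm_least)
      (use assms(2) in \<open>auto simp: psums_scale intro!: mult_left_mono fnorm_upper\<close>)
  show ?thesis
  proof (cases "c = 0")
    case True
    then show ?thesis using le[of 0 v] fnorm_nonneg[OF assms, of 0] by simp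
  next
    case False
    have "\<bar>c\<bar> * fnorm \<F> v \<le> \<bar>c\<bar> * (\<bar>inverse c\<bar> * fnorm \<F> (c *\<^sub>R v))"
      using le[of "inverse c" "c *\<^sub>R v"] False by (intro mult_left_mono) auto
    also have "\<dots> = fnorm \<F> (c *\<^sub>R v)" using False by (simp flip: mult.assoc abs_mult)
    finally show ?thesis using le[of c v] by simp
  qed
qed

text \<open>The single interval from 1 to \<open>r\<close> contributes the norm of
  \<open>psum r v\<close>, which tends to the norm of \<open>v\<close>.\<close>

lemma norm_le_fnorm:
  assumes "spreading_family \<F>" "psums_bdd \<F> D"
  shows "norm v \<le> fnorm \<F> v"
proof -
  have "norm (psum r v) \<le> fnorm \<F> v" for r
    using fnorm_upper[OF assms(2), of "{1}" "\<lambda>_. r" v] spreading_familyD(3)[OF assms(1), of 1]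
    by (simp add: separated_def psums_def proj_one[unfolded One_nat_def])
  then show ?thesis using tendsto_norm[OF psum_tendsto[of v]] by (intro LIMSEQ_le_const2) auto
qed

text \<open>Starts below \<open>a\<close> move up to \<open>a\<close>, right ends move down to
  \<open>b\<close>, and intervals missing \<open>{a..b}\<close> are dropped. Spreading and heredity
  keep the starts in \<open>\<G>\<close>, and the projections of \<open>v\<close> do not
  change.\<close>

lemma psums_truncate:
  assumes G: "spreading_family \<G>" and F: "F \<in> \<G>" and r: "separated F r"
    and v: "\<And>i. coef v i \<noteq> 0 \<Longrightarrow> a \<le> Suc i \<and> Suc i \<le> b"
  obtains F' r' where "F' \<in> \<G>" "separated F' r'" "F' \<subseteq> {a..b}" "\<forall>m\<in>F'. r' m \<le> b"
    "psums F' r' v = psums F r v"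
proof (cases "a \<le> b")
  case False
  have v0: "coef v i = 0" for i using v[of i] False by linarith
  have "proj m k v = 0" for m k by (rule coef_eqI) (simp add: coef_proj v0)
  then show thesis using that[of "{}" r] spreading_family_empty[OF G]
    by (simp add: psums_def separated_def)
next
  case True
  define H where "H = {m\<in>F. m \<le> b \<and> a \<le> r m}"
  define \<mu> where "\<mu> m = max m a" for m
  \<comment> \<open>Two starts cannot both be pushed to \<open>a\<close>: the interval of the first
    reaches \<open>a\<close>, so the second start lies beyond \<open>a\<close>.\<close>
  have mono: "strict_mono_on H \<mu>"
    using r by (intro strict_mono_onI) (fastforce simp: H_def \<mu>_def separated_def)
  have inj: "inj_on \<mu> H" using mono by (rule strict_mono_on_imp_inj_on)
  define r' where "r' x = min b (r (inv_into H \<mu> x))" for x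
  have r': "r' (\<mu> m) = min b (r m)" if "m \<in> H" for m using inj that by (simp add: r'_def)
  show thesis
  proof (rule that[of "\<mu> ` H" r'])
    show "\<mu> ` H \<in> \<G>"
      by (rule spreading_familyD(4)[OF G F _ mono]) (auto simp: H_def \<mu>_def)
    show "separated (\<mu> ` H) r'"
      unfolding separated_def
    proof (intro ballI impI)
      fix x x' assume "x \<in> \<mu> ` H" "x' \<in> \<mu> ` H" "x < x'"
      then obtain m m' where m: "m \<in> H" "m' \<in> H" "x = \<mu> m" "x' = \<mu> m'" "\<mu> m < \<mu> m'" by auto
      have "m < m'" using m strict_mono_on_less[OF mono m(1,2)] by simp
      then have "r m < m'" using r m(1,2) by (simp add: separated_def H_def)
      also have "m' \<le> \<mu> m'" by (simp add: \<mu>_def)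
      finally show "r' x < x'" using m r' by simp
    qed
    show "\<mu> ` H \<subseteq> {a..b}" using True by (auto simp: H_def \<mu>_def)
    show "\<forall>m\<in>\<mu> ` H. r' m \<le> b" by (simp add: r'_def)
    have fin: "finite F" using F G spreading_familyD(1) by blast
    have "psums (\<mu> ` H) r' v = (\<Sum>m\<in>H. norm (proj (\<mu> m) (min b (r m)) v))"
      unfolding psums_def by (subst sum.reindex[OF inj]) (simp add: r')
    also have "\<dots> = (\<Sum>m\<in>H. norm (proj m (r m) v))"
    proof (intro sum.cong refl arg_cong[of _ _ norm] coef_eqI)
      fix m i
      show "coef (proj (\<mu> m) (min b (r m)) v) i = coef (proj m (r m) v) i"
        using v[of i] by (cases "coef v i = 0") (auto simp: coef_proj \<mu>_def)
    qed
    also have "\<dots> = psums F r v"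
      unfolding psums_def
    proof (intro sum.mono_neutral_left ballI)
      fix m assume m: "m \<in> F - H"
      have "proj m (r m) v = 0"
      proof (rule coef_eqI)
        fix i
        show "coef (proj m (r m) v) i = coef 0 i"
          using v[of i] m by (cases "coef v i = 0") (auto simp: coef_proj H_def)
      qed
      then show "norm (proj m (r m) v) = 0" by simp
    qed (use fin in \<open>auto simp: H_def\<close>)
    finally show "psums (\<mu> ` H) r' v = psums F r v" .
  qed
qed

text \<open>After truncation the intervals chosen for \<open>z i\<close> lie between the ends of its
  support. So the families are successive, their minima move the admissible set to the right, and
  each interval sees only one block.\<close>

lemma psums_superadditive:
  assumes S: "spreading_family S" and G: "spreading_family \<G>"
    and z: "admissible S k z y"
    and F: "\<And>i. i < k \<Longrightarrow> F i \<in> \<G> \<and> separated (F i) (r i)"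
  obtains X t where "X \<in> fam_comp S \<G>" "separated X t"
    "psums X t (\<Sum>i<k. z i) = (\<Sum>i<k. psums (F i) (r i) (z i))"
proof -
  define a where "a i = Min (supp y (z i))" for i
  define b where "b i = Max (supp y (z i))" for i
  have zs: "z i \<in> span (range y)" "z i \<noteq> 0" if "i < k" for i
    using z that by (auto simp: admissible_def block_seq_on_def)
  have supp: "supp y (z i) = Suc ` {j. coef (z i) j \<noteq> 0}" "finite (supp y (z i))" "supp y (z i) \<noteq> {}"
    if "i < k" for i using supp_span[OF zs(1)[OF that]] zs(2)[OF that] by auto
  have ab: "a i \<le> Suc p \<and> Suc p \<le> b i" if "i < k" "coef (z i) p \<noteq> 0" for i p
    using supp[OF that(1)] that(2) by (auto simp: a_def b_def)
  have ba: "b i < a j" if "i < j" "j < k" for i j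
  proof -
    have "set_less (supp y (z i)) (supp y (z j))"
      using z that by (simp add: admissible_def block_seq_on_def)
    then show ?thesis using supp[of i] supp[of j] that by (simp add: a_def b_def set_less_def)
  qed
  have aS: "a ` {..<k} \<in> S" using z by (simp add: admissible_def a_def)
  define P where "P i F' r' \<longleftrightarrow> F' \<in> \<G> \<and> separated F' r' \<and> F' \<subseteq> {a i..b i} \<and>
      (\<forall>m\<in>F'. r' m \<le> b i) \<and> psums F' r' (z i) = psums (F i) (r i) (z i)" for i F' r'
  have "\<exists>F' r'. P i F' r'" if i: "i < k" for i
  proof -
    obtain F' r' where "F' \<in> \<G>" "separated F' r'" "F' \<subseteq> {a i..b i}" "\<forall>m\<in>F'. r' m \<le> b i"
      "psums F' r' (z i) = psums (F i) (r i) (z i)"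
      by (rule psums_truncate[OF G conjunct1[OF F[OF i]] conjunct2[OF F[OF i]] ab[OF i]])
    then show ?thesis unfolding P_def by blast
  qed
  then obtain F' r' where P: "\<And>i. i < k \<Longrightarrow> P i (F' i) (r' i)" by metis
  have F': "\<And>i. i < k \<Longrightarrow> F' i \<in> \<G>" "\<And>i. i < k \<Longrightarrow> separated (F' i) (r' i)"
      "\<And>i. i < k \<Longrightarrow> F' i \<subseteq> {a i..b i}" "\<And>i m. i < k \<Longrightarrow> m \<in> F' i \<Longrightarrow> r' i m \<le> b i"
      "\<And>i. i < k \<Longrightarrow> psums (F' i) (r' i) (z i) = psums (F i) (r i) (z i)"
    using P unfolding P_def by blast+
  have fin: "finite (F' i)" if "i < k" for i using F'(1)[OF that] G spreading_familyD(1) by blast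
  have ord: "set_less (F' i) (F' j)" if "i < j" "j < k" for i j
    using ba[OF that] F'(3)[of i] F'(3)[of j] that by (fastforce simp: set_less_def)
  have same: "i = j" if "i < k" "j < k" "m \<in> F' i" "m \<in> F' j" for i j m
    using ord[of i j] ord[of j i] that unfolding set_less_def
    by (cases i j rule: linorder_cases) blast+
  define X where "X = (\<Union>i<k. F' i)"
  \<comment> \<open>\<open>ix m\<close> recovers the block to which the start \<open>m\<close>
    belongs, so that the right ends can be glued into one function.\<close>
  define ix where "ix m = (SOME i. i < k \<and> m \<in> F' i)" for m
  define t where "t m = r' (ix m) m" for m
  have t: "t m = r' i m" if "i < k" "m \<in> F' i" for i m
  proof -
    have "ix m < k \<and> m \<in> F' (ix m)" 
      unfolding ix_def using that by (rule someI[of "\<lambda>i. i < k \<and> m \<in> F' i", OF conjI])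
    then have "ix m = i" using same that by blast
    then show ?thesis by (simp add: t_def)
  qed
  show thesis
  proof (rule that[of X t])
    define I where "I = {i. i < k \<and> F' i \<noteq> {}}"
    have "(\<Union>i\<in>I. F' i) \<in> fam_comp S \<G>"
    proof (rule fam_compI)
      show "finite I" by (simp add: I_def)
      show "F' i \<in> \<G> \<and> finite (F' i) \<and> F' i \<noteq> {}" if "i \<in> I" for i
        using that F'(1) fin by (simp add: I_def)
      show "set_less (F' i) (F' j) \<or> set_less (F' j) (F' i)" if "i \<in> I" "j \<in> I" "i \<noteq> j" for i j
        using ord[of i j] ord[of j i] that by (cases i j rule: linorder_cases) (auto simp: I_def)
      have le: "a i \<le> Min (F' i)" if "i \<in> I" for i
        using Min_in[of "F' i"] F'(3)[of i] fin[of i] that by (auto simp: I_def)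
      have a_le_b: "a i \<le> b i" if "i < k" for i
        using supp[OF that] Min_in[of "supp y (z i)"] by (simp add: a_def b_def)
      have less: "a i < a j" if "i < j" "j < k" for i j
        using ba[OF that] a_le_b[of i] that by linarith
      show "(\<lambda>i. Min (F' i)) ` I \<in> S"
      proof (rule spreading_family_index[OF S aS])
        show "a ` I \<subseteq> a ` {..<k}" by (auto simp: I_def)
        show "inj_on a I"
          using less by (intro linorder_inj_onI) (auto simp: I_def order_less_imp_not_eq)
        show "Min (F' i) < Min (F' j)" if "i \<in> I" "j \<in> I" "a i < a j" for i j
        proof -
          have "i < j" using less[of j i] that by (cases i j rule: linorder_cases) (auto simp: I_def)
          then show ?thesis using ord[of i j] that fin by (intro set_less_Min) (auto simp: I_def)
        qed
      qed (use le in auto)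
    qed
    also have "(\<Union>i\<in>I. F' i) = X" by (auto simp: I_def X_def)
    finally show "X \<in> fam_comp S \<G>" .
    show "separated X t"
      unfolding separated_def
    proof (intro ballI impI)
      fix m m' assume "m \<in> X" "m' \<in> X" "m < m'"
      then obtain i j where ij: "i < k" "m \<in> F' i" "j < k" "m' \<in> F' j" by (auto simp: X_def)
      have "r' i m < m'"
      proof (cases i j rule: linorder_cases)
        case less
        then show ?thesis using F'(4)[OF ij(1,2)] ba[OF less ij(3)] F'(3)[OF ij(3)] ij(4) by fastforce
      next
        case equal
        then show ?thesis using F'(2)[OF ij(1)] ij \<open>m < m'\<close> by (simp add: separated_def)
      next
        case greater
        then show ?thesis using ord[OF greater ij(1)] ij \<open>m < m'\<close> by (fastforce simp: set_less_def)
      qed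
      then show "t m < m'" using t ij by simp
    qed
    \<comment> \<open>The other blocks live outside \<open>{a i..b i}\<close>, so an interval inside
      it annihilates them.\<close>
    have "proj m (r' i m) (\<Sum>i<k. z i) = proj m (r' i m) (z i)" if i: "i < k" and m: "m \<in> F' i" for i m
    proof (rule coef_eqI)
      fix p
      have "coef (\<Sum>i<k. z i) p = coef (z i) p" if p: "m \<le> Suc p" "p < r' i m"
      proof -
        have range: "a i \<le> Suc p" "Suc p \<le> b i" using p F'(3)[OF i] F'(4)[OF i m] m by auto
        have "coef (z j) p = 0" if "j < k" "j \<noteq> i" for j
        proof (rule ccontr)
          assume "coef (z j) p \<noteq> 0"
          then have "a j \<le> Suc p" "Suc p \<le> b j" using ab that by blast+
          then show False using range ba[of i j] ba[of j i] i that
            by (cases i j rule: linorder_cases) auto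
        qed
        then have "(\<Sum>j<k. coef (z j) p) = (\<Sum>j\<in>{i}. coef (z j) p)"
          using i by (intro sum.mono_neutral_right) auto
        then show ?thesis by (simp add: coef_sum)
      qed
      then show "coef (proj m (r' i m) (\<Sum>i<k. z i)) p = coef (proj m (r' i m) (z i)) p"
        by (simp add: coef_proj)
    qed
    then have "psums (F' i) t (\<Sum>i<k. z i) = psums (F' i) (r' i) (z i)" if "i < k" for i
      unfolding psums_def using t that by (intro sum.cong refl) simp
    moreover have "psums X t v = (\<Sum>i<k. psums (F' i) t v)" for v
      unfolding psums_def X_def using fin same by (intro sum.UNION_disjoint) auto
    ultimately show "psums X t (\<Sum>i<k. z i) = (\<Sum>i<k. psums (F i) (r i) (z i))" using F'(5) by simp
  qed
qed

text \<open>By \<open>sum_cSup_le\<close> it suffices to treat one choice of intervals per block,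
  and \<open>psums_superadditive\<close> merges these choices into one competitor for the composed
  family.\<close>

lemma fnorm_superadditive:
  assumes S: "spreading_family S" and G: "spreading_family \<G>"
    and D: "psums_bdd \<G> D" "psums_bdd (fam_comp S \<G>) D'" and z: "admissible S k z y"
  shows "(\<Sum>i<k. fnorm \<G> (z i)) \<le> fnorm (fam_comp S \<G>) (\<Sum>i<k. z i)"
  unfolding fnorm_def[of \<G>]
proof (rule sum_cSup_le)
  fix s assume "\<And>i. i \<in> {..<k} \<Longrightarrow> s i \<in> psums_set \<G> (z i)"
  then have "\<forall>i. \<exists>F r. i < k \<longrightarrow> F \<in> \<G> \<and> separated F r \<and> s i = psums F r (z i)"
    by (fastforce simp: psums_set_def)
  then obtain F r where F: "\<And>i. i < k \<Longrightarrow> F i \<in> \<G> \<and> separated (F i) (r i) \<and> s i = psums (F i) (r i) (z i)"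
    by metis
  obtain X t where "X \<in> fam_comp S \<G>" "separated X t"
    "psums X t (\<Sum>i<k. z i) = (\<Sum>i<k. psums (F i) (r i) (z i))"
    using psums_superadditive[OF S G z, of F r] F by blast
  then show "sum s {..<k} \<le> fnorm (fam_comp S \<G>) (\<Sum>i<k. z i)"
    using fnorm_upper[OF D(2), of X t "\<Sum>i<k. z i"] F by simp
qed (use spreading_family_empty[OF G] D(1) in \<open>auto simp: psums_set_bdd psums_set_nonempty\<close>)

text \<open>The single block \<open>y 0\<close> bounds every competitor by 1, so the supremum in
  \<open>delta\<close> is a genuine upper bound.\<close>

lemma delta_ge:
  assumes S: "spreading_family S" and N: "N (y 0) > 0" and d: "d \<ge> 0"
    and le: "\<And>k z. admissible S k z y \<Longrightarrow> d * (\<Sum>i<k. N (z i)) \<le> N (\<Sum>i<k. z i)"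
  shows "d \<le> delta S N y"
  unfolding delta_def
proof (rule cSup_upper)
  have "admissible S 1 (\<lambda>_. y 0) y"
    using spreading_familyD(3)[OF S, of 1] basis_nonzero
    by (simp add: admissible_def block_seq_on_def supp_basis span_base lessThan_Suc)
  then show "bdd_above {d. 0 \<le> d \<and> (\<forall>k z. admissible S k z y \<longrightarrow> d * (\<Sum>i<k. N (z i)) \<le> N (\<Sum>i<k. z i))}"
    using N by (intro bdd_aboveI[of _ 1]) fastforce
qed (use d le in auto)

lemma block_seq_self: "block_seq_on UNIV y y"
  using basis_nonzero by (auto simp: block_seq_on_def supp_basis span_base set_less_def)

text \<open>Multiplication by \<open>\<theta>\<close> shifts the weights, and superadditivity turns
  the term of index \<open>j\<close> into the one of index \<open>j + 1\<close>. Compared with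
  \<open>N Z\<close>, the result lacks the bottom term \<open>q 0 Z\<close> and has an extra top
  term \<open>\<theta> ^ M * q M Z\<close>, which \<open>bdd\<close> makes no larger.\<close>

lemma renorming:
  assumes S: "spreading_family S" and \<theta>: "0 < \<theta>" and M: "1 \<le> M"
    and bdd: "psums_bdd (fam_iter S M) (1 / \<theta> ^ M)"
  obtains N where "equivalent_norm_on UNIV N" "\<theta> \<le> delta S N y"
proof -
  define q where "q j = fnorm (fam_iter S j)" for j
  define D where "D = 1 / \<theta> ^ M"
  define N where "N v = (\<Sum>j<M. \<theta> ^ j * q j v)" for v
  have sp: "spreading_family (fam_iter S j)" for j by (rule spreading_family_iter[OF S])
  have em: "{} \<in> fam_iter S j" for j by (rule spreading_family_empty[OF sp])
  \<comment> \<open>The families increase with the index, so the bound for \<open>M\<close> serves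
    all smaller indices.\<close>
  have bd: "psums_bdd (fam_iter S j) D" if "j \<le> M" for j
    using bdd fam_iter_mono[OF S that] unfolding psums_bdd_def D_def by blast
  have q_le: "q j v \<le> D * norm v" if "j \<le> M" for j v
    unfolding q_def by (rule fnorm_le[OF em bd[OF that]])
  have q0: "norm v \<le> q 0 v" for v unfolding q_def by (rule norm_le_fnorm[OF sp bd]) simp
  have qnn: "0 \<le> q j v" if "j < M" for j v
    using fnorm_nonneg[OF em bd] that by (simp add: q_def)
  have q0_N: "q 0 v \<le> N v" for v
  proof -
    have "(\<Sum>j\<in>{0}. \<theta> ^ j * q j v) \<le> N v"
      unfolding N_def using M \<theta> qnn by (intro sum_mono2) auto
    then show ?thesis by simp
  qed
  have N_norm: "norm v \<le> N v" for v using q0[of v] q0_N[of v] by linarith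
  have N_le: "N v \<le> ((\<Sum>j<M. \<theta> ^ j * D) + 1) * norm v" for v
  proof -
    have "N v \<le> (\<Sum>j<M. \<theta> ^ j * (D * norm v))"
      unfolding N_def using \<theta> by (intro sum_mono mult_left_mono q_le) auto
    then show ?thesis by (simp add: sum_distrib_right distrib_right mult.assoc add_increasing2)
  qed
  have N_scale: "N (c *\<^sub>R v) = \<bar>c\<bar> * N v" for c v
    unfolding N_def q_def sum_distrib_left
    by (intro sum.cong refl) (simp add: fnorm_scale[OF em bd])
  have N_triangle: "N (v + w) \<le> N v + N w" for v w
    unfolding N_def q_def sum.distrib[symmetric] distrib_left[symmetric]
    using \<theta> by (intro sum_mono mult_left_mono fnorm_triangle[OF em bd]) auto
  have N_zero: "N 0 = 0" using N_scale[of 0 0] by simp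
  have N_nonneg: "0 \<le> N v" for v using N_norm[of v] norm_ge_zero order_trans by blast
  have "0 < (\<Sum>j<M. \<theta> ^ j * D) + 1"
    using \<theta> by (intro add_nonneg_pos sum_nonneg) (auto simp: D_def)
  then have "equivalent_norm_on UNIV N"
    unfolding equivalent_norm_on_def
  proof (intro conjI ballI allI)
    show "N v = 0 \<longleftrightarrow> v = 0" for v using N_norm[of v] N_zero by auto
    assume "0 < (\<Sum>j<M. \<theta> ^ j * D) + 1"
    then show "\<exists>c C. 0 < c \<and> 0 < C \<and> (\<forall>v\<in>UNIV. c * norm v \<le> N v \<and> N v \<le> C * norm v)"
      using N_norm N_le by (intro exI[of _ 1] exI[of _ "(\<Sum>j<M. \<theta> ^ j * D) + 1"]) simp
  qed (use N_scale N_triangle N_nonneg in auto)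
  moreover have "\<theta> \<le> delta S N y"
  proof (rule delta_ge[OF S])
    show "0 < N (y 0)" using N_norm[of "y 0"] basis_nonzero[of 0] zero_less_norm_iff[of "y 0"] by linarith
    fix k z assume z: "admissible S k z y"
    define Z where "Z = (\<Sum>i<k. z i)"
    have step: "(\<Sum>i<k. q j (z i)) \<le> q (Suc j) Z" if "j < M" for j
      unfolding q_def Z_def fam_iter_Suc
      by (rule fnorm_superadditive[OF S sp bd _ z]) (use that bd[of "Suc j"] in auto)
    have "\<theta> ^ M * q M Z \<le> \<theta> ^ M * (D * norm Z)"
      using \<theta> by (intro mult_left_mono q_le) auto
    also have "\<dots> = norm Z" using \<theta> by (simp add: D_def)
    also have "\<dots> \<le> q 0 Z" by (rule q0)
    finally have top: "\<theta> ^ M * q M Z \<le> q 0 Z" .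
    have "\<theta> * (\<Sum>i<k. N (z i)) = (\<Sum>j<M. \<theta> ^ Suc j * (\<Sum>i<k. q j (z i)))"
      unfolding N_def by (subst sum.swap) (simp add: sum_distrib_left mult.assoc)
    also have "\<dots> \<le> (\<Sum>j<M. \<theta> ^ Suc j * q (Suc j) Z)"
      using \<theta> step by (intro sum_mono mult_left_mono) auto
    also have "\<dots> = (\<Sum>j<Suc M. \<theta> ^ j * q j Z) - q 0 Z" by (subst sum.lessThan_Suc_shift) simp
    also have "\<dots> = N Z + \<theta> ^ M * q M Z - q 0 Z" by (simp add: N_def)
    also have "\<dots> \<le> N Z" using top by simp
    finally show "\<theta> * (\<Sum>i<k. N (z i)) \<le> N (\<Sum>i<k. z i)" by (simp add: Z_def)
  qed (use \<theta> in simp)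
  ultimately show thesis by (rule that)
qed

end

section \<open>Choice of the parameters and restriction to the closed span\<close>

lemma equivalent_norm_on_subset:
  "equivalent_norm_on X N \<Longrightarrow> Y \<subseteq> X \<Longrightarrow> equivalent_norm_on Y N"
  unfolding equivalent_norm_on_def by (meson subsetD)

lemma equivalent_norm_on_norm: "equivalent_norm_on X norm"
  unfolding equivalent_norm_on_def by (auto simp: norm_triangle_ineq intro!: exI[of _ 1])

theorem theorem4p20:
  fixes y :: "nat \<Rightarrow> 'a::banach"
    and e :: "omega1 \<Rightarrow> nat \<Rightarrow> omega1"
    and \<alpha> :: omega1 and n :: nat and \<epsilon> \<theta> :: real
  assumes "schauder_basis y"
    and "fundamental_system e"
    and "n \<ge> 1" and "\<epsilon> > 0"
    and "\<theta> \<ge> 0" and "\<theta> ^ n = delta (fam_power (schreier e \<alpha>) n) norm y"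
  shows "\<exists>(x :: nat \<Rightarrow> 'a) (N :: 'a \<Rightarrow> real).
           block_seq_on UNIV x y \<and>
           equivalent_norm_on (closed_span x) N \<and>
           delta (schreier e \<alpha>) N x \<ge> \<theta> - \<epsilon>"
proof -
  interpret basis_seq y by unfold_locales (rule assms(1))
  define S where "S = schreier e \<alpha>"
  have S: "spreading_family S" unfolding S_def by (rule spreading_family_schreier[OF assms(2)])
  have "\<exists>N. equivalent_norm_on UNIV N \<and> \<theta> - \<epsilon> \<le> delta S N y"
  \<comment> \<open>If \<open>\<theta> \<le> \<epsilon>\<close>, the given norm serves, since its
    \<open>delta\<close> is nonnegative.\<close>
  proof (cases "\<theta> - \<epsilon> \<le> 0")
    case True
    have "0 \<le> delta S norm y"
      by (rule delta_ge[OF S]) (auto simp: basis_nonzero)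
    then show ?thesis using equivalent_norm_on_norm True by (intro exI[of _ norm]) simp
  next
    case False
    define \<theta>' where "\<theta>' = \<theta> - \<epsilon>"
    have \<theta>': "0 < \<theta>'" "\<theta>' < \<theta>" using False assms(4) by (auto simp: \<theta>'_def)
    obtain K where K: "K \<ge> 1" "\<And>n v. norm (psum n v) \<le> K * norm v" using psum_bounded by blast
    have "1 < (\<theta> / \<theta>') ^ n" using \<theta>' assms(3) by (intro one_less_power) auto
    \<comment> \<open>The gain from passing to the smaller \<open>\<theta>'\<close> must outweigh
      the factor \<open>2 * K\<^sup>2\<close> lost in \<open>psums_bound\<close>.\<close>
    then obtain m where m: "2 * K\<^sup>2 < ((\<theta> / \<theta>') ^ n) ^ m" using real_arch_pow by blast
    \<comment> \<open>The new norm needs at least one summand; \<open>K \<ge> 1\<close> excludes the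
      degenerate exponent.\<close>
    have "m \<noteq> 0"
    proof
      assume "m = 0"
      then have "2 * K\<^sup>2 < 1" using m by simp
      moreover have "1 \<le> K\<^sup>2" using K(1) by (simp add: one_le_power)
      ultimately show False by simp
    qed
    then have M: "1 \<le> n * m" using assms(3) by simp
    have "lower_est (fam_power S n) (\<theta> ^ n)"
      using lower_est_delta[OF spreading_family_power[OF S]] assms(6) by (simp add: S_def)
    then have "lower_est (fam_iter S n) (\<theta> ^ n)"
      using lower_est_antimono fam_iter_subset_power[OF assms(3)] by blast
    then have est: "lower_est (fam_iter S (n * m)) (\<theta> ^ (n * m))"
      using lower_est_iter[OF S, of n "\<theta> ^ n" m] assms(5) by (simp add: power_mult)
    have "psums_bdd (fam_iter S (n * m)) (1 / \<theta>' ^ (n * m))"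
      unfolding psums_bdd_def
    proof (intro ballI allI impI)
      fix F r v assume F: "F \<in> fam_iter S (n * m)" "separated F r"
      have "\<theta> ^ (n * m) * psums F r v \<le> 2 * K\<^sup>2 * norm v"
        by (rule psums_bound[OF K(2,1) est _ spreading_family_iter[OF S] F]) (use assms(5) in simp)
      also have "\<dots> \<le> ((\<theta> / \<theta>') ^ n) ^ m * norm v" using m by (intro mult_right_mono) auto
      also have "\<dots> = \<theta> ^ (n * m) * (1 / \<theta>' ^ (n * m) * norm v)"
        by (simp add: power_mult power_divide)
      finally show "psums F r v \<le> 1 / \<theta>' ^ (n * m) * norm v"
        using \<theta>' by (subst (asm) mult_le_cancel_left_pos) auto
    qed
    then show ?thesis using renorming[OF S \<theta>'(1) M] unfolding \<theta>'_def by metis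
  qed
  then obtain N where "equivalent_norm_on UNIV N" "\<theta> - \<epsilon> \<le> delta S N y" by blast
  then show ?thesis
    using block_seq_self equivalent_norm_on_subset by (intro exI[of _ y] exI[of _ N]) (auto simp: S_def)
qed

end
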